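(* Let $\Phi$ be an almost total Turing functional. If $Y\in\mathsf{W2R}_{\lambda_\Phi}$, then there is some $X\in\mathsf{W2R}$ with $X\in\mathrm{dom}(\Phi)$ and $\Phi(X)=Y$.
   Context: $2^{<\omega}$ is the set of finite binary strings, $\preceq$ the prefix order; $\lambda$ is the uniform measure on $2^\omega$. A Turing functional $\Phi$ is a c.e. set of pairs $(\sigma,\tau)$ of strings such that whenever $(\sigma,\tau),(\sigma',\tau')\in\Phi$ and $\sigma\preceq\sigma'$, $\tau,\tau'$ are comparable; $\Phi^X$ is the maximal finite or infinite sequence extending every $\tau$ with $(\sigma,\tau)\in\Phi$ for some $\sigma\preceq X$; $\mathrm{dom}(\Phi)=\{X:\Phi^X\text{ infinite}\}$ and $\Phi(X)=\Phi^X$ there. $\Phi$ is almost total if $\lambda(\mathrm{dom}(\Phi))=1$; then $\lambda_\Phi(\sigma)=\lambda(\{X:\Phi^X\succeq\sigma\})$ defines a computable probability measure. For a computable measure $\mu$, $X\in\mathsf{W2R}_\mu$ iff $X\notin\bigcap_i\mathcal U_i$ for every uniformly effectively open sequence $(\mathcal U_i)$ of subsets of $2^\omega$ with $\lim_i\mu(\mathcal U_i)=0$; $\mathsf{W2R}=\mathsf{W2R}_\lambda$. *)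

theory Defs
  imports "HOL-Probability.Probability" "HOL-Library.Sublist" "HOL-Library.Nat_Bijection"
begin

datatype recf = Z | S | Proj nat | Comp recf "recf list" | Prim recf recf | Mu recf

inductive eval :: "recf \<Rightarrow> nat list \<Rightarrow> nat \<Rightarrow> bool" where
  eval_Z: "eval Z xs 0"
| eval_S: "eval S (x # xs) (Suc x)"
| eval_Proj: "i < length xs \<Longrightarrow> eval (Proj i) xs (xs ! i)"
| eval_Comp: "list_all2 (\<lambda>g y. eval g xs y) gs ys \<Longrightarrow> eval f ys z \<Longrightarrow> eval (Comp f gs) xs z"
| eval_Prim0: "eval f xs z \<Longrightarrow> eval (Prim f g) (0 # xs) z"
| eval_PrimS: "eval (Prim f g) (y # xs) r \<Longrightarrow> eval g (r # y # xs) z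
     \<Longrightarrow> eval (Prim f g) (Suc y # xs) z"
| eval_Mu: "eval f (y # xs) 0 \<Longrightarrow> (\<forall>z<y. \<exists>v. 0 < v \<and> eval f (z # xs) v)
     \<Longrightarrow> eval (Mu f) xs y"

definition ce_set :: "nat set \<Rightarrow> bool" where
  "ce_set A \<longleftrightarrow> (\<exists>f. \<forall>n. n \<in> A \<longleftrightarrow> (\<exists>v. eval f [n] v))"

text \<open>Bijective coding of finite binary strings by naturals.\<close>
fun str_code :: "bool list \<Rightarrow> nat" where
  "str_code [] = 0"
| "str_code (b # bs) = 2 * str_code bs + (if b then 2 else 1)"

definition ce_strpairs :: "(bool list \<times> bool list) set \<Rightarrow> bool" where
  "ce_strpairs R \<longleftrightarrow> ce_set ((\<lambda>(a, b). prod_encode (str_code a, str_code b)) ` R)"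

definition ce_natstr :: "(nat \<times> bool list) set \<Rightarrow> bool" where
  "ce_natstr R \<longleftrightarrow> ce_set ((\<lambda>(i, b). prod_encode (i, str_code b)) ` R)"

definition prefix_of :: "bool list \<Rightarrow> (nat \<Rightarrow> bool) \<Rightarrow> bool" where
  "prefix_of \<sigma> X \<longleftrightarrow> (\<forall>i<length \<sigma>. X i = \<sigma> ! i)"

definition cyl :: "bool list \<Rightarrow> (nat \<Rightarrow> bool) set" where
  "cyl \<sigma> = {X. prefix_of \<sigma> X}"

definition cantor :: "(nat \<Rightarrow> bool) measure" where
  "cantor = PiM UNIV (\<lambda>_. measure_pmf (pmf_of_set (UNIV :: bool set)))"

definition turing_functional :: "(bool list \<times> bool list) set \<Rightarrow> bool" where
  "turing_functional \<Phi> \<longleftrightarrow> ce_strpairs \<Phi> \<and>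
     (\<forall>\<sigma> \<tau> \<sigma>' \<tau>'. (\<sigma>, \<tau>) \<in> \<Phi> \<longrightarrow> (\<sigma>', \<tau>') \<in> \<Phi> \<longrightarrow> prefix \<sigma> \<sigma>' \<longrightarrow>
        (prefix \<tau> \<tau>' \<or> prefix \<tau>' \<tau>))"

text \<open>outputs of Phi along X; Phi^X is the union (sup) of these\<close>
definition outs :: "(bool list \<times> bool list) set \<Rightarrow> (nat \<Rightarrow> bool) \<Rightarrow> bool list set" where
  "outs \<Phi> X = {\<tau>. \<exists>\<sigma>. (\<sigma>, \<tau>) \<in> \<Phi> \<and> prefix_of \<sigma> X}"

definition phi_ext :: "(bool list \<times> bool list) set \<Rightarrow> (nat \<Rightarrow> bool) \<Rightarrow> bool list \<Rightarrow> bool" where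
  "phi_ext \<Phi> X \<sigma> \<longleftrightarrow> (\<exists>\<tau>\<in>outs \<Phi> X. prefix \<sigma> \<tau>)"

definition phi_dom :: "(bool list \<times> bool list) set \<Rightarrow> (nat \<Rightarrow> bool) set" where
  "phi_dom \<Phi> = {X. \<forall>n. \<exists>\<tau>\<in>outs \<Phi> X. n \<le> length \<tau>}"

definition phi_apply :: "(bool list \<times> bool list) set \<Rightarrow> (nat \<Rightarrow> bool) \<Rightarrow> (nat \<Rightarrow> bool)" where
  "phi_apply \<Phi> X = (\<lambda>n. THE b. \<exists>\<tau>\<in>outs \<Phi> X. n < length \<tau> \<and> \<tau> ! n = b)"

definition almost_total :: "(bool list \<times> bool list) set \<Rightarrow> bool" where
  "almost_total \<Phi> \<longleftrightarrow> measure cantor (phi_dom \<Phi>) = 1"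

definition eff_open :: "(nat \<times> bool list) set \<Rightarrow> nat \<Rightarrow> (nat \<Rightarrow> bool) set" where
  "eff_open W i = (\<Union>\<sigma>\<in>{\<sigma>. (i, \<sigma>) \<in> W}. cyl \<sigma>)"

definition W2R :: "(nat \<Rightarrow> bool) measure \<Rightarrow> (nat \<Rightarrow> bool) set" where
  "W2R \<mu> = {X. \<not> (\<exists>W. ce_natstr W \<and> (\<lambda>i. measure \<mu> (eff_open W i)) \<longlonglongrightarrow> 0
                     \<and> X \<in> (\<Inter>i. eff_open W i))}"

end

theory Submission
  imports Defs
begin

text \<open>
  Write \<open>\<lambda>\<close> for the uniform measure and \<open>E \<tau>\<close> for the set of oracles whose image extends \<open>\<tau>\<close>.
  Given a test \<open>U\<close> with \<open>\<lambda> (U i) \<longlonglongrightarrow> 0\<close> and a number \<open>k\<close>, let \<open>V i\<close> be the union of the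
  cylinders of all \<open>\<tau>\<close> with \<open>\<mu> [\<tau>] < 2 ^ k * \<lambda> (U i \<inter> E \<tau>)\<close>. By the maximal inequality
  \<open>\<mu> (V i) \<le> 2 ^ k * \<lambda> (U i)\<close>, and \<open>V\<close> is uniformly effectively open because almost totality
  makes \<open>\<mu> [\<tau>]\<close> computable. Hence \<open>Y\<close> avoids some \<open>V i\<close>, so \<open>U i\<close> occupies at most the fraction
  \<open>2 ^ -k\<close> of \<open>E \<tau>\<close> for every prefix \<open>\<tau>\<close> of \<open>Y\<close>. Doing this for all of the countably many tests, the
  \<open>k\<close>-th one with the bound \<open>2 ^ -(k + 2)\<close>, one obtains an open set \<open>G\<close> that contains a
  component of every test and covers at most half of every \<open>E \<tau>\<close>. By compactness there is an \<open>X\<close> outside \<open>G\<close> all of whose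
  outputs are compatible with \<open>Y\<close>. It is weakly 2-random, hence lies in the domain (the complement of
  the domain is a union of effectively closed null sets), and is therefore mapped to \<open>Y\<close>.
\<close>

section \<open>Recursive functions and semirecursive predicates\<close>

text \<open>A function of finitely many variables is represented by a function of an infinite environment
  that assigns values to the variables 0, 1, 2, and so on; binding a variable shifts the environment.
  This makes composition and quantification free of arities.\<close>

definition total_rec :: "((nat \<Rightarrow> nat) \<Rightarrow> nat) \<Rightarrow> bool" where
  "total_rec F \<longleftrightarrow> (\<exists>f n. \<forall>m\<ge>n. \<forall>e. eval f (map e [0..<m]) (F e))"

lemma total_rec_proj: "total_rec (\<lambda>e. e i)"
proof -
  have "eval (Proj i) (map e [0..<m]) (e i)" if "m \<ge> Suc i" for m and e :: "nat \<Rightarrow> nat"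
    using eval_Proj[of i "map e [0..<m]"] that by simp
  then show ?thesis unfolding total_rec_def by blast
qed

lemma total_rec_zero: "total_rec (\<lambda>e. 0)"
  unfolding total_rec_def using eval_Z by blast

text \<open>All \<open>G i\<close> are substituted at once, but \<open>H\<close> reads only its
  first \<open>n\<close> variables, so a finite composition suffices; it works from the largest
  threshold of these \<open>n\<close> functions on.\<close>

lemma total_rec_subst:
  assumes "total_rec H" and "\<And>i. total_rec (G i)"
  shows "total_rec (\<lambda>e. H (\<lambda>i. G i e))"
proof -
  obtain f n where f: "\<And>e. eval f (map e [0..<n]) (H e)"
    using assms(1) unfolding total_rec_def by blast
  obtain g N where g: "\<And>i m e. m \<ge> N i \<Longrightarrow> eval (g i) (map e [0..<m]) (G i e)"
    using assms(2) unfolding total_rec_def by metis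
  have "eval (Comp f (map g [0..<n])) (map e [0..<m]) (H (\<lambda>i. G i e))"
    if m: "m \<ge> Max (N ` {..<n} \<union> {0})" for m e
  proof (rule eval_Comp)
    have "m \<ge> N i" if "i < n" for i
      using m that by (meson Max_ge UnI1 finite.emptyI finite.insertI finite_UnI finite_imageI finite_lessThan imageI le_trans lessThan_iff)
    then show "list_all2 (\<lambda>h y. eval h (map e [0..<m]) y) (map g [0..<n]) (map (\<lambda>i. G i e) [0..<n])"
      using g by (auto simp: list_all2_conv_all_nth)
  qed (use f in auto)
  then show ?thesis unfolding total_rec_def by blast
qed

lemma total_rec_Suc: "total_rec F \<Longrightarrow> total_rec (\<lambda>e. Suc (F e))"
proof -
  assume "total_rec F"
  then obtain f n where f: "\<And>m e. m \<ge> n \<Longrightarrow> eval f (map e [0..<m]) (F e)"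
    unfolding total_rec_def by blast
  have "eval (Comp S [f]) (map e [0..<m]) (Suc (F e))" if "m \<ge> n" for m e
    by (rule eval_Comp[where ys = "[F e]"]) (use f that eval_S in auto)
  then show ?thesis unfolding total_rec_def by blast
qed

text \<open>In the step function, variable 0 is the previous value and variable 1 the counter, the
  order in which \<open>Prim\<close> passes them; the parameters are shifted by two.\<close>

lemma total_rec_rec_nat:
  assumes "total_rec A" and "total_rec (\<lambda>e. B (e 0) (e (Suc 0)) (\<lambda>i. e (Suc (Suc i))))"
    and "total_rec N"
  shows "total_rec (\<lambda>e. rec_nat (A e) (\<lambda>y r. B r y e) (N e))"
proof -
  obtain f n1 where f: "\<And>m e. m \<ge> n1 \<Longrightarrow> eval f (map e [0..<m]) (A e)"
    using assms(1) unfolding total_rec_def by blast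
  obtain g n2 where g: "\<And>m e. m \<ge> n2 \<Longrightarrow>
      eval g (map e [0..<m]) (B (e 0) (e (Suc 0)) (\<lambda>i. e (Suc (Suc i))))"
    using assms(2) unfolding total_rec_def by blast
  obtain h n3 where h: "\<And>m e. m \<ge> n3 \<Longrightarrow> eval h (map e [0..<m]) (N e)"
    using assms(3) unfolding total_rec_def by blast
  have rec: "eval (Prim f g) (k # map e [0..<m]) (rec_nat (A e) (\<lambda>y r. B r y e) k)"
    if "m \<ge> max n1 n2" for m e k
  proof (induction k)
    case 0
    show ?case using eval_Prim0 f that by simp
  next
    case (Suc k)
    let ?r = "rec_nat (A e) (\<lambda>y r. B r y e) k"
    have "eval g (?r # k # map e [0..<m]) (B ?r k e)"
      using g[of "Suc (Suc m)" "case_nat ?r (case_nat k e)"] that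
      by (simp add: map_upt_Suc del: upt_Suc)
    with eval_PrimS[OF Suc] show ?case by simp
  qed
  \<comment> \<open>A composition has a fixed list of arguments, whereas \<open>m\<close> varies, so
    the recursion is run on the first \<open>m0\<close> parameters only.\<close>
  have "eval (Comp (Prim f g) (h # map Proj [0..<m0])) (map e [0..<m])
      (rec_nat (A e) (\<lambda>y r. B r y e) (N e))"
    if "m \<ge> max m0 n3" "m0 = max n1 n2" for m0 m e
  proof (rule eval_Comp[where ys = "N e # map e [0..<m0]"])
    have "eval (Proj i) (map e [0..<m]) (e i)" if "i < m0" for i
      using eval_Proj[of i "map e [0..<m]"] that \<open>m \<ge> max m0 n3\<close> by simp
    then show "list_all2 (\<lambda>h y. eval h (map e [0..<m]) y) (h # map Proj [0..<m0]) (N e # map e [0..<m0])"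
      using h that by (auto simp: list.rel_map list.rel_refl_strong list_all2_same)
  qed (use rec that in auto)
  then show ?thesis unfolding total_rec_def by blast
qed

lemma total_rec_shift: "total_rec F \<Longrightarrow> total_rec (\<lambda>e. F (\<lambda>i. e (Suc i)))"
  by (rule total_rec_subst[where G = "\<lambda>i e. e (Suc i)"]) (auto intro: total_rec_proj)

lemma total_rec_shift2: "total_rec F \<Longrightarrow> total_rec (\<lambda>e. F (\<lambda>i. e (Suc (Suc i))))"
  by (rule total_rec_subst[where G = "\<lambda>i e. e (Suc (Suc i))"]) (auto intro: total_rec_proj)

lemma total_rec_subst0:
  "total_rec (\<lambda>e. F (e 0) (\<lambda>i. e (Suc i))) \<Longrightarrow> total_rec (\<lambda>e. F (e (Suc 0)) (\<lambda>i. e (Suc (Suc i))))"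
  by (drule total_rec_shift) simp

section \<open>Closure of the recursive functions under arithmetic\<close>

lemma total_rec_const: "total_rec (\<lambda>e. c)"
  by (induction c) (auto intro: total_rec_zero total_rec_Suc)

lemma total_rec_add: 
  assumes "total_rec F" "total_rec G"
  shows "total_rec (\<lambda>e. F e + G e)"
proof -
  have "total_rec (\<lambda>e. rec_nat (F e) (\<lambda>y r. Suc r) (G e))"
    by (intro total_rec_rec_nat assms total_rec_Suc total_rec_proj)
  moreover have "rec_nat a (\<lambda>y r. Suc r) b = a + b" for a b by (induction b) auto
  ultimately show ?thesis by simp
qed

lemma total_rec_diff: 
  assumes "total_rec F" "total_rec G"
  shows "total_rec (\<lambda>e. F e - G e)"
proof -
  have "total_rec (\<lambda>e. rec_nat 0 (\<lambda>y r. y) (e 0))"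
    by (intro total_rec_rec_nat assms total_rec_zero total_rec_proj)
  moreover have "rec_nat 0 (\<lambda>y r. y) b = b - 1" for b by (cases b) auto
  ultimately have "total_rec (\<lambda>e. e 0 - 1)" by simp
  then have "total_rec (\<lambda>e. rec_nat (F e) (\<lambda>y r. r - 1) (G e))"
    by (intro total_rec_rec_nat assms)
  moreover have "rec_nat a (\<lambda>y r. r - 1) b = a - b" for a b by (induction b) auto
  ultimately show ?thesis by simp
qed

lemma total_rec_mult: 
  assumes "total_rec F" "total_rec G"
  shows "total_rec (\<lambda>e. F e * G e)"
proof -
  have "total_rec (\<lambda>e. rec_nat 0 (\<lambda>y r. r + F e) (G e))"
    by (intro total_rec_rec_nat assms total_rec_zero total_rec_add total_rec_proj total_rec_shift2)
  moreover have "rec_nat 0 (\<lambda>y r. r + a) b = a * b" for a b :: nat by (induction b) auto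
  ultimately show ?thesis by simp
qed

lemma total_rec_power: 
  assumes "total_rec F" "total_rec G"
  shows "total_rec (\<lambda>e. F e ^ G e)"
proof -
  have "total_rec (\<lambda>e. rec_nat 1 (\<lambda>y r. r * F e) (G e))"
    by (intro total_rec_rec_nat assms total_rec_const total_rec_mult total_rec_proj total_rec_shift2)
  moreover have "rec_nat 1 (\<lambda>y r. r * a) b = a ^ b" for a b :: nat by (induction b) auto
  ultimately show ?thesis by simp
qed

lemma total_rec_sum: 
  assumes "total_rec N" "total_rec (\<lambda>e. F (e 0) (\<lambda>i. e (Suc i)))"
  shows "total_rec (\<lambda>e. \<Sum>y<N e. F y e)"
proof -
  have "total_rec (\<lambda>e. rec_nat 0 (\<lambda>y r. r + F y e) (N e))"
    by (intro total_rec_rec_nat assms total_rec_zero total_rec_add total_rec_proj total_rec_subst0)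
  moreover have "rec_nat 0 (\<lambda>y r. r + F y e) b = (\<Sum>y<b. F y e)" for b e by (induction b) auto
  ultimately show ?thesis by simp
qed

lemma total_rec_prod_encode:
  assumes "total_rec F" "total_rec G"
  shows "total_rec (\<lambda>e. prod_encode (F e, G e))"
proof -
  have "triangle n = (\<Sum>y<n. Suc y)" for n by (induction n) auto
  then have "prod_encode (a, b) = (\<Sum>y<a + b. Suc y) + a" for a b
    by (simp add: prod_encode_def)
  then show ?thesis
    by (simp only:) (intro total_rec_add total_rec_sum total_rec_Suc total_rec_proj assms)
qed

section \<open>Decidable predicates and bounded quantifiers\<close>

definition dec_pred :: "((nat \<Rightarrow> nat) \<Rightarrow> bool) \<Rightarrow> bool" where
  "dec_pred P \<longleftrightarrow> total_rec (\<lambda>e. of_bool (P e))"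

lemma total_rec_case_nat:
  "total_rec A \<Longrightarrow> (\<And>j. total_rec (\<lambda>e. E e j)) \<Longrightarrow> total_rec (\<lambda>e. case_nat (A e) (E e) i)"
  by (cases i) auto

lemma dec_pred_subst:
  assumes "dec_pred P" and "\<And>i. total_rec (\<lambda>e. E e i)"
  shows "dec_pred (\<lambda>e. P (E e))"
  using total_rec_subst[OF assms(1)[unfolded dec_pred_def] assms(2)] unfolding dec_pred_def .

lemma dec_pred_not: "dec_pred P \<Longrightarrow> dec_pred (\<lambda>e. \<not> P e)"
proof -
  assume "dec_pred P"
  then have "total_rec (\<lambda>e. 1 - of_bool (P e))"
    unfolding dec_pred_def by (intro total_rec_diff total_rec_const)
  moreover have "1 - of_bool b = (of_bool (\<not> b) :: nat)" for b by simp
  ultimately show ?thesis unfolding dec_pred_def by (simp only:)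
qed

lemma dec_pred_conj: "dec_pred P \<Longrightarrow> dec_pred Q \<Longrightarrow> dec_pred (\<lambda>e. P e \<and> Q e)"
  unfolding dec_pred_def of_bool_conj by (rule total_rec_mult)

lemma dec_pred_le:
  assumes "total_rec F" "total_rec G"
  shows "dec_pred (\<lambda>e. F e \<le> G e)"
proof -
  have "of_bool (a \<le> b) = 1 - (a - b)" for a b :: nat by auto
  then show ?thesis unfolding dec_pred_def
    by (simp only:) (intro total_rec_diff total_rec_const assms)
qed

lemma dec_pred_less: "total_rec F \<Longrightarrow> total_rec G \<Longrightarrow> dec_pred (\<lambda>e. F e < G e)"
  using dec_pred_not[OF dec_pred_le[of G F]] by (simp add: not_le)

lemma dec_pred_eq: "total_rec F \<Longrightarrow> total_rec G \<Longrightarrow> dec_pred (\<lambda>e. F e = G e)"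
  using dec_pred_conj[OF dec_pred_le[of F G] dec_pred_le[of G F]] by (simp add: order_eq_iff)

lemma dec_pred_bex:
  assumes "total_rec N" "dec_pred (\<lambda>e. P (e 0) (\<lambda>i. e (Suc i)))"
  shows "dec_pred (\<lambda>e. \<exists>y<N e. P y e)"
proof -
  have "dec_pred (\<lambda>e. 0 < (\<Sum>y<N e. of_bool (P y e) :: nat))"
    by (rule dec_pred_less[OF total_rec_zero total_rec_sum])
      (use assms in \<open>auto simp: dec_pred_def\<close>)
  moreover have "0 < (\<Sum>y<n. of_bool (Q y) :: nat) \<longleftrightarrow> (\<exists>y<n. Q y)" for n and Q :: "nat \<Rightarrow> bool"
    by (auto simp: sum_nonneg_eq_0_iff simp flip: neq0_conv)
  ultimately show ?thesis by simp
qed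

lemma dec_pred_ball:
  assumes "total_rec N" "dec_pred (\<lambda>e. P (e 0) (\<lambda>i. e (Suc i)))"
  shows "dec_pred (\<lambda>e. \<forall>y<N e. P y e)"
  using dec_pred_not[OF dec_pred_bex[OF assms(1) dec_pred_not[OF assms(2)]]] by simp

lemma total_rec_if:
  assumes "dec_pred P" "total_rec F" "total_rec G"
  shows "total_rec (\<lambda>e. if P e then F e else G e)"
proof -
  have "(if P e then F e else G e) = of_bool (P e) * F e + (1 - of_bool (P e)) * G e" for e
    by simp
  with assms show ?thesis unfolding dec_pred_def
    by (simp only:) (intro total_rec_add total_rec_mult total_rec_diff total_rec_const)
qed

text \<open>Evaluation with all unbounded searches cut off at a given stage. The result is the successor
  of the value, or 0 if no value has been found yet.\<close>

fun stage_eval :: "recf \<Rightarrow> nat \<Rightarrow> nat list \<Rightarrow> nat" where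
  "stage_eval Z s xs = 1"
| "stage_eval S s xs = (case xs of [] \<Rightarrow> 0 | x # _ \<Rightarrow> Suc (Suc x))"
| "stage_eval (Proj i) s xs = (if i < length xs then Suc (xs ! i) else 0)"
| "stage_eval (Comp f gs) s xs =
     (if \<forall>g\<in>set gs. 0 < stage_eval g s xs
      then stage_eval f s (map (\<lambda>g. stage_eval g s xs - 1) gs) else 0)"
| "stage_eval (Prim f g) s xs = (case xs of [] \<Rightarrow> 0 | n # ys \<Rightarrow>
     rec_nat (stage_eval f s ys)
       (\<lambda>y r. if 0 < r then stage_eval g s ((r - 1) # y # ys) else 0) n)"
| "stage_eval (Mu f) s xs =
     (\<Sum>y<s. if stage_eval f s (y # xs) = 1 \<and> (\<forall>z<y. 1 < stage_eval f s (z # xs))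
             then Suc y else 0)"

text \<open>At most one summand is nonzero, because a least zero is unique, so the sum expresses a
  bounded search. For staged values, 1 codes the result 0, and more than 1 codes a positive
  result.\<close>

lemma mu_sum_eq:
  fixes h :: "nat \<Rightarrow> nat"
  shows "(\<Sum>y<s. if h y = 1 \<and> (\<forall>z<y. 1 < h z) then Suc y else 0) = Suc v \<longleftrightarrow>
    v < s \<and> h v = 1 \<and> (\<forall>z<v. 1 < h z)"
    (is "?l = _ \<longleftrightarrow> _")
proof -
  have *: "?l = (if v < s then Suc v else 0)" if v: "h v = 1 \<and> (\<forall>z<v. 1 < h z)" for v
  proof -
    have "h y = 1 \<and> (\<forall>z<y. 1 < h z) \<longleftrightarrow> y = v" for y
      using v by (metis less_irrefl linorder_neqE_nat)
    then have "?l = (\<Sum>y<s. if y = v then Suc y else 0)" by simp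
    then show ?thesis by simp
  qed
  show ?thesis
  proof (cases "\<exists>w. h w = 1 \<and> (\<forall>z<w. 1 < h z)")
    case True
    then obtain w where w: "h w = 1 \<and> (\<forall>z<w. 1 < h z)" by blast
    have "v = w" if "h v = 1 \<and> (\<forall>z<v. 1 < h z)"
      using w that by (metis less_irrefl linorder_neqE_nat)
    then show ?thesis unfolding *[OF w] using w by auto
  next
    case False
    then have "?l = 0" by auto
    then show ?thesis using False by auto
  qed
qed

lemma stage_eval_sound: "stage_eval f s xs = Suc v \<Longrightarrow> eval f xs v"
proof (induction f arbitrary: xs v)
  case (Comp f gs)
  then have pos: "\<forall>g\<in>set gs. 0 < stage_eval g s xs"
    and v: "stage_eval f s (map (\<lambda>g. stage_eval g s xs - 1) gs) = Suc v"
    by (auto split: if_splits)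
  have "eval g xs (stage_eval g s xs - 1)" if "g \<in> set gs" for g
    using Comp.IH(2)[OF that] pos that by auto
  then show ?case
    by (intro eval_Comp[OF _ Comp.IH(1)[OF v]]) (auto simp: list_all2_conv_all_nth)
next
  case (Prim f g)
  then obtain n ys where xs: "xs = n # ys" by (auto split: list.splits)
  have "eval (Prim f g) (n # ys) v" if "stage_eval (Prim f g) s (n # ys) = Suc v" for n v
    using that
  proof (induction n arbitrary: v)
    case 0
    then show ?case using Prim.IH(1) by (auto intro: eval_Prim0)
  next
    case (Suc n)
    have "stage_eval (Prim f g) s (n # ys) \<noteq> 0"
      using Suc.prems by (intro notI) simp
    then obtain r where r: "stage_eval (Prim f g) s (n # ys) = Suc r"
      using not0_implies_Suc by blast
    with Suc.prems have "stage_eval g s (r # n # ys) = Suc v" by simp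
    with Suc.IH[OF r] show ?case by (blast intro: eval_PrimS Prim.IH(2))
  qed
  with xs Prim.prems show ?case by blast
next
  case (Mu f)
  then have "stage_eval f s (v # xs) = Suc 0" "\<forall>z<v. 1 < stage_eval f s (z # xs)"
    using mu_sum_eq by auto
  with Mu.IH show ?case
    by (intro eval_Mu) (auto, metis less_imp_Suc_add add_Suc zero_less_Suc)
next
  case S
  then show ?case by (auto split: list.splits intro: eval_S)
qed (auto intro: eval.intros split: if_splits)

lemma stage_eval_mono: "stage_eval f s xs = Suc v \<Longrightarrow> s \<le> t \<Longrightarrow> stage_eval f t xs = Suc v"
proof (induction f arbitrary: xs v)
  case (Comp f gs)
  then have pos: "\<forall>g\<in>set gs. 0 < stage_eval g s xs"
    and v: "stage_eval f s (map (\<lambda>g. stage_eval g s xs - 1) gs) = Suc v"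
    by (auto split: if_splits)
  have eq: "stage_eval g t xs = stage_eval g s xs" if "g \<in> set gs" for g
    using Comp.IH(2)[OF that _ Comp.prems(2)] pos that by (metis Suc_pred)
  have "map (\<lambda>g. stage_eval g t xs - 1) gs = map (\<lambda>g. stage_eval g s xs - 1) gs"
    using eq by simp
  then have "stage_eval f t (map (\<lambda>g. stage_eval g t xs - 1) gs) = Suc v"
    using Comp.IH(1)[OF v Comp.prems(2)] by (simp only:)
  then show ?case using eq pos by simp
next
  case (Prim f g)
  then obtain n ys where xs: "xs = n # ys" by (auto split: list.splits)
  have "stage_eval (Prim f g) t (n # ys) = Suc v" if "stage_eval (Prim f g) s (n # ys) = Suc v" for n v
    using that
  proof (induction n arbitrary: v)
    case 0
    then show ?case using Prim.IH(1) Prim.prems(2) by auto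
  next
    case (Suc n)
    have "stage_eval (Prim f g) s (n # ys) \<noteq> 0"
      using Suc.prems by (intro notI) simp
    then obtain r where r: "stage_eval (Prim f g) s (n # ys) = Suc r"
      using not0_implies_Suc by blast
    with Suc.prems have "stage_eval g s (r # n # ys) = Suc v" by simp
    then have "stage_eval g t (r # n # ys) = Suc v" using Prim.IH(2) Prim.prems(2) by blast
    with Suc.IH[OF r] show ?case by simp
  qed
  with xs Prim.prems show ?case by blast
next
  case (Mu f)
  then have s: "v < s" "stage_eval f s (v # xs) = Suc 0" "\<forall>z<v. 1 < stage_eval f s (z # xs)"
    using mu_sum_eq by auto
  \<comment> \<open>Every argument up to \<open>v\<close> has already converged at stage
    \<open>s\<close>, so no smaller zero can appear later.\<close>
  have "stage_eval f t (z # xs) = stage_eval f s (z # xs)" if "z \<le> v" for z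
  proof -
    have "stage_eval f s (z # xs) \<noteq> 0"
      using s(2) s(3)[rule_format, of z] that by (cases "z = v") auto
    then show ?thesis using Mu.IH Mu.prems(2) by (metis not0_implies_Suc)
  qed
  then show ?case using s Mu.prems(2) by (simp only: stage_eval.simps mu_sum_eq) auto
qed (auto split: if_splits)

text \<open>A derivation of \<open>eval\<close> uses finitely many subcomputations; by monotonicity
  one stage that dominates all of theirs works. Sums serve as upper bounds.\<close>

lemma stage_eval_complete: "eval f xs v \<Longrightarrow> \<exists>s. stage_eval f s xs = Suc v"
proof (induction rule: eval.induct)
  case (eval_Comp xs gs ys f z)
  then obtain s0 where s0: "stage_eval f s0 ys = Suc z" by blast
  have len: "length gs = length ys" using eval_Comp by (auto dest: list_all2_lengthD)
  have "\<forall>i<length gs. \<exists>s. stage_eval (gs ! i) s xs = Suc (ys ! i)"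
    using eval_Comp by (auto simp: list_all2_conv_all_nth)
  then obtain sg where sg: "\<And>i. i < length gs \<Longrightarrow> stage_eval (gs ! i) (sg i) xs = Suc (ys ! i)"
    by metis
  define t where "t = s0 + (\<Sum>i<length gs. sg i)"
  have "sg i \<le> t" if "i < length gs" for i
    using member_le_sum[of i "{..<length gs}" sg] that unfolding t_def by auto
  with sg have t: "stage_eval (gs ! i) t xs = Suc (ys ! i)" if "i < length gs" for i
    using stage_eval_mono that by blast
  then have "map (\<lambda>g. stage_eval g t xs - 1) gs = ys"
    using len by (auto intro: nth_equalityI)
  moreover have "\<forall>g\<in>set gs. 0 < stage_eval g t xs"
    using t by (auto simp: in_set_conv_nth)
  moreover have "stage_eval f t ys = Suc z" using stage_eval_mono[OF s0] t_def by simp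
  ultimately show ?case by (intro exI[of _ t]) simp
next
  case (eval_PrimS f g y xs r z)
  then obtain s1 s2 where "stage_eval (Prim f g) s1 (y # xs) = Suc r"
     "stage_eval g s2 (r # y # xs) = Suc z" by blast
  then have "stage_eval (Prim f g) (max s1 s2) (y # xs) = Suc r"
     "stage_eval g (max s1 s2) (r # y # xs) = Suc z"
    using stage_eval_mono by (meson max.cobounded1 max.cobounded2)+
  then show ?case by (intro exI[of _ "max s1 s2"]) simp
next
  case (eval_Mu f y xs)
  then obtain s0 where s0: "stage_eval f s0 (y # xs) = Suc 0" by blast
  obtain w sg where sg: "\<And>z. z < y \<Longrightarrow> 0 < w z \<and> stage_eval f (sg z) (z # xs) = Suc (w z)"
    using eval_Mu by metis
  \<comment> \<open>\<open>Suc y\<close> is added because the search at stage \<open>t\<close>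
    inspects only arguments less than \<open>t\<close>.\<close>
  define t where "t = Suc y + s0 + (\<Sum>i<y. sg i)"
  have "sg i \<le> t" if "i < y" for i
    using member_le_sum[of i "{..<y}" sg] that unfolding t_def by auto
  then have "\<forall>z<y. 1 < stage_eval f t (z # xs)"
    using stage_eval_mono sg by (metis One_nat_def Suc_less_eq)
  moreover have "stage_eval f t (y # xs) = Suc 0" using stage_eval_mono[OF s0] t_def by simp
  moreover have "y < t" by (simp add: t_def)
  ultimately have "stage_eval (Mu f) t xs = Suc y"
    by (simp only: stage_eval.simps mu_sum_eq) auto
  then show ?case by blast
qed (auto split: list.splits)

lemma eval_deterministic: "eval f xs v \<Longrightarrow> eval f xs w \<Longrightarrow> v = w"
  using stage_eval_complete stage_eval_mono by (metis Suc_inject nle_le)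

lemma dec_pred_ball_list:
  "(\<And>x. x \<in> set xs \<Longrightarrow> dec_pred (P x)) \<Longrightarrow> dec_pred (\<lambda>e. \<forall>x\<in>set xs. P x e)"
proof (induction xs)
  case Nil
  then show ?case by (simp add: dec_pred_def total_rec_const)
next
  case (Cons a xs)
  then show ?case by (simp add: dec_pred_conj)
qed

text \<open>Induction on the fixed program \<open>f\<close>. The stage \<open>t\<close> and the
  arguments \<open>ts\<close> stay arbitrary because recursion and search shift the environment past
  the variables that they bind.\<close>

lemma total_rec_stage_eval:
  "total_rec t \<Longrightarrow> (\<And>g. g \<in> set ts \<Longrightarrow> total_rec g) \<Longrightarrow>
    total_rec (\<lambda>e. stage_eval f (t e) (map (\<lambda>g. g e) ts))"
proof (induction f arbitrary: t ts)
  case Z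
  then show ?case by (simp add: total_rec_const)
next
  case S
  then show ?case by (cases ts) (auto intro!: total_rec_Suc total_rec_zero)
next
  case (Proj i)
  then show ?case by (cases "i < length ts") (auto intro!: total_rec_Suc total_rec_zero)
next
  case (Comp f gs)
  have IH2: "total_rec (\<lambda>e. stage_eval g (t e) (map (\<lambda>g. g e) ts))" if "g \<in> set gs" for g
    using Comp that by blast
  have "total_rec (\<lambda>e. stage_eval f (t e)
      (map (\<lambda>h. h e) (map (\<lambda>g e. stage_eval g (t e) (map (\<lambda>g. g e) ts) - 1) gs)))"
    by (rule Comp.IH(1)) (use Comp.prems in \<open>auto intro!: total_rec_diff total_rec_const IH2\<close>)
  then have "total_rec (\<lambda>e. stage_eval f (t e)
      (map (\<lambda>g. stage_eval g (t e) (map (\<lambda>g. g e) ts) - 1) gs))"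
    by (simp add: comp_def)
  then show ?case
    by (simp del: One_nat_def)
      (intro total_rec_if dec_pred_ball_list dec_pred_less total_rec_zero IH2; assumption)
next
  case (Prim f g)
  show ?case
  proof (cases ts)
    case Nil
    then show ?thesis by (simp add: total_rec_const)
  next
    case (Cons n us)
    let ?sh = "\<lambda>h e. h (\<lambda>i. e (Suc (Suc i)))"
    have "total_rec (\<lambda>e. stage_eval g (?sh t e)
       (map (\<lambda>h. h e) ((\<lambda>e. e 0 - 1) # (\<lambda>e. e (Suc 0)) # map ?sh us)))"
      by (rule Prim.IH(2)) 
        (use Prim.prems Cons in \<open>auto intro!: total_rec_shift2 total_rec_diff[OF total_rec_proj total_rec_const, of _ 1, simplified] total_rec_proj\<close>)
    then have g: "total_rec (\<lambda>e. stage_eval g (?sh t e)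
       ((e 0 - 1) # e (Suc 0) # map (\<lambda>h. ?sh h e) us))"
      by (simp add: comp_def)
    have "total_rec (\<lambda>e. rec_nat (stage_eval f (t e) (map (\<lambda>h. h e) us))
       (\<lambda>y r. if 0 < r then stage_eval g (t e) ((r - 1) # y # map (\<lambda>h. h e) us) else 0) (n e))"
      by (intro total_rec_rec_nat total_rec_if dec_pred_less total_rec_proj total_rec_zero g Prim.IH(1))
        (use Prim.prems Cons in auto)
    then show ?thesis using Cons by simp
  qed
next
  case (Mu f)
  let ?sh = "\<lambda>h e. h (\<lambda>i. e (Suc i))"
  have "total_rec (\<lambda>e. stage_eval f (?sh t e) (map (\<lambda>h. h e) ((\<lambda>e. e 0) # map ?sh ts)))"
    by (rule Mu.IH) (use Mu.prems in \<open>auto intro!: total_rec_shift total_rec_proj\<close>)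
  then have 1: "total_rec (\<lambda>e. stage_eval f (?sh t e) (e 0 # map (\<lambda>h. ?sh h e) ts))"
    by (simp add: comp_def)
  \<comment> \<open>The second copy is for the inner quantifier, under which both \<open>z\<close>
    and \<open>y\<close> are bound.\<close>
  let ?sh2 = "\<lambda>h e. h (\<lambda>i. e (Suc (Suc i)))"
  have "total_rec (\<lambda>e. stage_eval f (?sh2 t e) (map (\<lambda>h. h e) ((\<lambda>e. e 0) # map ?sh2 ts)))"
    by (rule Mu.IH) (use Mu.prems in \<open>auto intro!: total_rec_shift2 total_rec_proj\<close>)
  then have 2: "total_rec (\<lambda>e. stage_eval f (?sh2 t e) (e 0 # map (\<lambda>h. ?sh2 h e) ts))"
    by (simp add: comp_def)
  have "total_rec (\<lambda>e. \<Sum>y<t e. if stage_eval f (t e) (y # map (\<lambda>g. g e) ts) = 1 \<and>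
     (\<forall>z<y. 1 < stage_eval f (t e) (z # map (\<lambda>g. g e) ts)) then Suc y else 0)"
    by (intro total_rec_sum total_rec_if dec_pred_conj dec_pred_eq dec_pred_ball dec_pred_less
        total_rec_const total_rec_Suc total_rec_proj 1 2 Mu.prems)
  then show ?case by simp
qed

section \<open>Semirecursive predicates in Sigma-1 normal form\<close>

definition semirec :: "((nat \<Rightarrow> nat) \<Rightarrow> bool) \<Rightarrow> bool" where
  "semirec P \<longleftrightarrow> (\<exists>R. dec_pred R \<and> (\<forall>e. P e \<longleftrightarrow> (\<exists>s. R (case_nat s e))))"

lemma semirecI:
  assumes "dec_pred (\<lambda>e. R (e 0) (\<lambda>i. e (Suc i)))" and "\<And>e. P e \<longleftrightarrow> (\<exists>s. R s e)"
  shows "semirec P"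
  unfolding semirec_def by (rule exI, rule conjI[OF assms(1)]) (simp add: assms(2))

lemma semirec_dec: "dec_pred P \<Longrightarrow> semirec P"
  by (rule semirecI[where R = "\<lambda>s. P"]) (auto intro: dec_pred_subst[of P] total_rec_proj)

lemma semirec_subst:
  assumes "semirec P" and E: "\<And>i. total_rec (\<lambda>e. E e i)"
  shows "semirec (\<lambda>e. P (E e))"
proof -
  obtain R where R: "dec_pred R" "\<And>e. P e \<longleftrightarrow> (\<exists>s. R (case_nat s e))"
    using assms(1) unfolding semirec_def by blast
  show ?thesis
    by (rule semirecI[where R = "\<lambda>s e. R (case_nat s (E e))"])
      (auto simp: R(2) intro!: dec_pred_subst[OF R(1)] total_rec_case_nat total_rec_proj
        total_rec_shift[OF E])
qed

text \<open>Two witnesses are merged into one strict upper bound, and the search for both of them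
  below it is decidable.\<close>

lemma semirec_conj:
  assumes "semirec P" "semirec Q"
  shows "semirec (\<lambda>e. P e \<and> Q e)"
proof -
  obtain R where R: "dec_pred R" "\<And>e. P e \<longleftrightarrow> (\<exists>s. R (case_nat s e))"
    using assms(1) unfolding semirec_def by blast
  obtain T where T: "dec_pred T" "\<And>e. Q e \<longleftrightarrow> (\<exists>s. T (case_nat s e))"
    using assms(2) unfolding semirec_def by blast
  show ?thesis
  proof (rule semirecI[where R = "\<lambda>s e. (\<exists>u<s. R (case_nat u e)) \<and> (\<exists>u<s. T (case_nat u e))"])
    show "dec_pred (\<lambda>e. (\<exists>u<e 0. R (case_nat u (\<lambda>i. e (Suc i)))) \<and>
        (\<exists>u<e 0. T (case_nat u (\<lambda>i. e (Suc i)))))"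
      by (intro dec_pred_conj dec_pred_bex total_rec_proj dec_pred_subst[OF R(1)]
          dec_pred_subst[OF T(1)] total_rec_case_nat)
    fix e
    have "\<exists>s. (\<exists>u<s. R (case_nat u e)) \<and> (\<exists>u<s. T (case_nat u e))"
      if "R (case_nat s e)" "T (case_nat t e)" for s t
      using that by (intro exI[of _ "Suc (max s t)"]) (auto intro: exI[of _ s] exI[of _ t])
    then show "P e \<and> Q e \<longleftrightarrow> (\<exists>s. (\<exists>u<s. R (case_nat u e)) \<and> (\<exists>u<s. T (case_nat u e)))"
      using R(2) T(2) by blast
  qed
qed

lemma semirec_ex:
  assumes "semirec (\<lambda>e. P (e 0) (\<lambda>i. e (Suc i)))"
  shows "semirec (\<lambda>e. \<exists>x. P x e)"
proof -
  obtain R where R: "dec_pred R" "\<And>e. P (e 0) (\<lambda>i. e (Suc i)) \<longleftrightarrow> (\<exists>s. R (case_nat s e))"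
    using assms unfolding semirec_def by blast
  have P: "P x e \<longleftrightarrow> (\<exists>s. R (case_nat s (case_nat x e)))" for x e
    using R(2)[of "case_nat x e"] by simp
  show ?thesis
  proof (rule semirecI[where R = "\<lambda>t e. \<exists>s<t. \<exists>x<t. R (case_nat s (case_nat x e))"])
    show "dec_pred (\<lambda>e. \<exists>s<e 0. \<exists>x<e 0. R (case_nat s (case_nat x (\<lambda>i. e (Suc i)))))"
      by (intro dec_pred_bex total_rec_proj dec_pred_subst[OF R(1)] total_rec_case_nat)
    fix e
    have "\<exists>t. \<exists>s<t. \<exists>x<t. R (case_nat s (case_nat x e))"
      if "R (case_nat s (case_nat x e))" for s x
      using that by (intro exI[of _ "Suc (max s x)"] exI[of _ s] exI[of _ x] conjI) auto
    then show "(\<exists>x. P x e) \<longleftrightarrow> (\<exists>t. \<exists>s<t. \<exists>x<t. R (case_nat s (case_nat x e)))"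
      unfolding P by blast
  qed
qed

text \<open>Finitely many true instances have witnesses below a common \<open>t\<close>, so the
  count at \<open>t\<close> is exact, while at any stage it is a lower bound. This is what makes
  lower bounds on measures of effectively open sets enumerable.\<close>

lemma semirec_card_ge:
  assumes "total_rec K" "total_rec N" "semirec (\<lambda>e. P (e 0) (\<lambda>i. e (Suc i)))"
  shows "semirec (\<lambda>e. K e \<le> card {x. x < N e \<and> P x e})"
proof -
  obtain R where R: "dec_pred R" "\<And>e. P (e 0) (\<lambda>i. e (Suc i)) \<longleftrightarrow> (\<exists>s. R (case_nat s e))"
    using assms(3) unfolding semirec_def by blast
  have P: "P x e \<longleftrightarrow> (\<exists>s. R (case_nat s (case_nat x e)))" for x e
    using R(2)[of "case_nat x e"] by simp
  define T where "T x t e \<longleftrightarrow> (\<exists>s<t. R (case_nat s (case_nat x e)))" for x t e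
  have P_T: "P x e \<longleftrightarrow> (\<exists>t. T x t e)" for x e unfolding P T_def by blast
  have T_mono: "T x t e \<Longrightarrow> t \<le> u \<Longrightarrow> T x u e" for x t u e
    unfolding T_def by (meson order_less_le_trans)
  have card: "card {x. x < n \<and> Q x} = (\<Sum>x<n. of_bool (Q x))" for n and Q :: "nat \<Rightarrow> bool"
    by (simp add: Collect_conj_eq lessThan_def[symmetric])
  show ?thesis
  proof (rule semirecI[where R = "\<lambda>t e. K e \<le> (\<Sum>x<N e. of_bool (T x t e))"])
    have "dec_pred (\<lambda>e. T (e 0) (e (Suc 0)) (\<lambda>i. e (Suc (Suc i))))"
      unfolding T_def
      by (intro dec_pred_bex total_rec_proj dec_pred_subst[OF R(1)] total_rec_case_nat)
    then show "dec_pred (\<lambda>e. K (\<lambda>i. e (Suc i)) \<le>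
        (\<Sum>x<N (\<lambda>i. e (Suc i)). of_bool (T x (e 0) (\<lambda>i. e (Suc i)))))"
      using assms(1,2) unfolding dec_pred_def[of "\<lambda>e. T (e 0) (e (Suc 0)) (\<lambda>i. e (Suc (Suc i)))"]
      by (intro dec_pred_le total_rec_sum total_rec_shift)
    fix e
    have "\<exists>t. \<forall>x<n. P x e \<longrightarrow> T x t e" for n
    proof (induction n)
      case (Suc n)
      then obtain t where t: "\<forall>x<n. P x e \<longrightarrow> T x t e" by blast
      obtain u where "P n e \<longrightarrow> T n u e" using P_T by blast
      with t show ?case
        by (intro exI[of _ "max t u"]) (auto simp: less_Suc_eq intro: T_mono)
    qed auto
    then obtain t where "\<forall>x<N e. P x e \<longrightarrow> T x t e" by blast
    then have t: "{x. x < N e \<and> T x t e} = {x. x < N e \<and> P x e}" using P_T by blast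
    have le: "card {x. x < N e \<and> T x s e} \<le> card {x. x < N e \<and> P x e}" for s
      by (rule card_mono) (use P_T in auto)
    show "K e \<le> card {x. x < N e \<and> P x e} \<longleftrightarrow> (\<exists>t. K e \<le> (\<Sum>x<N e. of_bool (T x t e)))"
      unfolding card[symmetric]
    proof
      show "\<exists>t. K e \<le> card {x. x < N e \<and> T x t e}" if "K e \<le> card {x. x < N e \<and> P x e}"
        using that unfolding t[symmetric] by blast
    qed (use le order_trans in blast)
  qed
qed

lemma semirec_ce_set:
  assumes "ce_set A" "total_rec F"
  shows "semirec (\<lambda>e. F e \<in> A)"
proof -
  obtain f where f: "\<And>n. n \<in> A \<longleftrightarrow> (\<exists>v. eval f [n] v)"
    using assms(1) unfolding ce_set_def by blast
  have A: "n \<in> A \<longleftrightarrow> (\<exists>s. 0 < stage_eval f s [n])" for n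
    unfolding f using stage_eval_sound stage_eval_complete
    by (metis not0_implies_Suc neq0_conv zero_less_Suc)
  show ?thesis
  proof (rule semirecI[where R = "\<lambda>s e. 0 < stage_eval f s [F e]"])
    show "dec_pred (\<lambda>e. 0 < stage_eval f (e 0) [F (\<lambda>i. e (Suc i))])"
      using total_rec_stage_eval[of "\<lambda>e. e 0" "[\<lambda>e. F (\<lambda>i. e (Suc i))]" f] assms(2)
      by (intro dec_pred_less total_rec_zero) (simp add: total_rec_proj total_rec_shift)
  qed (rule A)
qed

lemma ce_set_semirec:
  assumes "semirec (\<lambda>e. e 0 \<in> A)"
  shows "ce_set A"
proof -
  obtain R where R: "dec_pred R" "\<And>e. e 0 \<in> A \<longleftrightarrow> (\<exists>s. R (case_nat s e))"
    using assms unfolding semirec_def by blast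
  \<comment> \<open>The predicate is negated because \<open>Mu\<close> searches for a zero.\<close>
  from dec_pred_not[OF R(1)]
  obtain f n where f: "\<And>m e. m \<ge> n \<Longrightarrow> eval f (map e [0..<m]) (of_bool (\<not> R e))"
    unfolding dec_pred_def total_rec_def by blast
  define env where "env x = (\<lambda>i::nat. if i = 0 then x else 0 :: nat)" for x
  \<comment> \<open>The copies of \<open>Z\<close> pad the two arguments to length
    \<open>n + 2\<close>, beyond the threshold from which \<open>f\<close> is correct; they match
    the zeros in \<open>env x\<close>.\<close>
  define g where "g = Comp f ([Proj 0, Proj 1] @ replicate n Z)"
  have g: "eval g [s, x] (of_bool (\<not> R (case_nat s (env x))))" for s x
    unfolding g_def
  proof (rule eval_Comp[where ys = "[s, x] @ replicate n 0"])
    have "map (env x) [0..<Suc n] = x # replicate n 0"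
      by (simp add: map_upt_Suc env_def map_replicate_const del: upt_Suc)
    then have "map (case_nat s (env x)) [0..<Suc (Suc n)] = [s, x] @ replicate n 0"
      by (subst map_upt_Suc) simp
    then show "eval f ([s, x] @ replicate n 0) (of_bool (\<not> R (case_nat s (env x))))"
      using f[of "Suc (Suc n)" "case_nat s (env x)"] by (simp del: upt_Suc)
    have "eval (Proj 0) [s, x] s" "eval (Proj 1) [s, x] x"
      using eval_Proj[of 0 "[s, x]"] eval_Proj[of 1 "[s, x]"] by auto
    then show "list_all2 (\<lambda>h y. eval h [s, x] y) ([Proj 0, Proj 1] @ replicate n Z) ([s, x] @ replicate n 0)"
      by (auto simp: list_all2_conv_all_nth nth_Cons split: nat.splits intro: eval_Z)
  qed
  have "x \<in> A \<longleftrightarrow> (\<exists>v. eval (Mu g) [x] v)" for x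
  proof
    assume "x \<in> A"
    then have "\<exists>s. R (case_nat s (env x))" using R(2)[of "env x"] by (simp add: env_def)
    then obtain s where s: "R (case_nat s (env x))" "\<And>t. t < s \<Longrightarrow> \<not> R (case_nat t (env x))"
      using exists_least_iff[of "\<lambda>s. R (case_nat s (env x))"] by blast
    have "eval (Mu g) [x] s"
    proof (rule eval_Mu)
      show "eval g [s, x] 0" using g[of s x] s by simp
      show "\<forall>t<s. \<exists>v. 0 < v \<and> eval g [t, x] v" 
      proof (intro allI impI exI conjI)
        show "eval g [t, x] 1" if "t < s" for t using g[of t x] s(2)[OF that] by simp
      qed simp
    qed
    then show "\<exists>v. eval (Mu g) [x] v" by blast
  next
    assume "\<exists>v. eval (Mu g) [x] v"
    then obtain v where "eval g [v, x] 0" by (auto elim: eval.cases)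
    then have "of_bool (\<not> R (case_nat v (env x))) = (0 :: nat)"
      using g[of v x] eval_deterministic by blast
    then have "R (case_nat v (env x))" by simp
    then show "x \<in> A" using R(2)[of "env x"] by (auto simp: env_def)
  qed
  then show ?thesis unfolding ce_set_def by blast
qed

section \<open>Binary strings and the uniform measure\<close>

lemma str_code_append: "str_code (xs @ ys) = str_code xs + 2 ^ length xs * str_code ys"
  by (induction xs) (auto simp: algebra_simps)

text \<open>The code is bijective base 2 with digits 1 and 2, least significant first. Hence the
  strings of length \<open>n\<close> occupy the codes from \<open>2 ^ n - 1\<close> to
  \<open>2 ^ (n + 1) - 2\<close>.\<close>

lemma str_code_bounds: "2 ^ length xs \<le> Suc (str_code xs) \<and> Suc (str_code xs) < 2 ^ Suc (length xs)"
  by (induction xs) auto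

lemma inj_str_code: "inj str_code"
proof (rule injI)
  show "str_code xs = str_code ys \<Longrightarrow> xs = ys" for xs ys
  proof (induction xs arbitrary: ys)
    case Nil
    then show ?case by (cases ys) (auto split: if_splits)
  next
    case (Cons b xs)
    then obtain c zs where ys: "ys = c # zs" by (cases ys) (auto split: if_splits)
    have "b = c" using Cons.prems unfolding ys by (auto split: if_splits) presburger+
    then show ?case using Cons unfolding ys by auto
  qed
qed

lemma str_code_eq_iff [simp]: "str_code xs = str_code ys \<longleftrightarrow> xs = ys"
  using inj_str_code by (simp add: inj_eq)

lemma surj_str_code: "\<exists>xs. str_code xs = c"
proof (induction c rule: less_induct)
  case (less c)
  show ?case
  proof (cases "c = 0")
    case True
    then show ?thesis by (intro exI[of _ "[]"]) simp
  next
    case False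
    then have "(c - 1) div 2 < c" by auto
    with less obtain xs where xs: "str_code xs = (c - 1) div 2" by blast
    show ?thesis
    proof (cases "even c")
      case True
      with False xs show ?thesis by (intro exI[of _ "True # xs"]) (auto elim!: evenE)
    next
      case False
      with xs show ?thesis by (intro exI[of _ "False # xs"]) (auto elim!: oddE)
    qed
  qed
qed

lemma length_eq_iff_str_code:
  "length xs = n \<longleftrightarrow> 2 ^ n \<le> Suc (str_code xs) \<and> Suc (str_code xs) < 2 ^ Suc n"
proof
  assume *: "2 ^ n \<le> Suc (str_code xs) \<and> Suc (str_code xs) < 2 ^ Suc n"
  have "(2::nat) ^ n < 2 ^ Suc (length xs)" "(2::nat) ^ length xs < 2 ^ Suc n"
    using * str_code_bounds[of xs] by linarith+
  then show "length xs = n" by (simp only: power_strict_increasing_iff)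
qed (use str_code_bounds in blast)

text \<open>Here \<open>n\<close> is the length of \<open>xs\<close> and \<open>r\<close> the code
  of the remaining string. Both are bounded by codes, which makes the prefix relation
  decidable.\<close>

lemma prefix_iff_str_code:
  "prefix xs ys \<longleftrightarrow> (\<exists>n<Suc (str_code xs). \<exists>r<Suc (str_code ys).
     2 ^ n \<le> Suc (str_code xs) \<and> Suc (str_code xs) < 2 ^ Suc n \<and>
     str_code ys = str_code xs + 2 ^ n * r)"
  (is "_ \<longleftrightarrow> ?r")
proof
  assume "prefix xs ys"
  then obtain zs where ys: "ys = xs @ zs" by (auto elim: prefixE)
  have "length xs < Suc (str_code xs)"
    using str_code_bounds[of xs] less_exp[of "length xs"] by linarith
  moreover have "str_code zs \<le> 2 ^ length xs * str_code zs" by simp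
  then have "str_code zs < Suc (str_code ys)" unfolding ys str_code_append by linarith
  ultimately show ?r using str_code_bounds[of xs] str_code_append ys by blast
next
  assume ?r
  then obtain n r where n: "2 ^ n \<le> Suc (str_code xs) \<and> Suc (str_code xs) < 2 ^ Suc n"
    and ys: "str_code ys = str_code xs + 2 ^ n * r" by blast
  obtain zs where "str_code zs = r" using surj_str_code by blast
  moreover have "length xs = n" using n length_eq_iff_str_code by blast
  ultimately have "str_code ys = str_code (xs @ zs)" using ys str_code_append by simp
  then show "prefix xs ys" by simp
qed

lemma prefix_of_iff_map: "prefix_of xs X \<longleftrightarrow> map X [0..<length xs] = xs"
  unfolding prefix_of_def by (subst list_eq_iff_nth_eq) simp

lemma prefix_of_map: "prefix_of (map X [0..<n]) X"
  by (simp add: prefix_of_def)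

lemma prefix_of_prefix: "prefix xs ys \<Longrightarrow> prefix_of ys X \<Longrightarrow> prefix_of xs X"
  by (auto simp: prefix_of_def prefix_def nth_append)

lemma prefix_of_le:
  assumes "prefix_of xs X" "prefix_of ys X" "length xs \<le> length ys"
  shows "prefix xs ys"
proof -
  have "take (length xs) ys = xs"
    using assms by (auto simp: prefix_of_def list_eq_iff_nth_eq)
  then show ?thesis by (metis take_is_prefix)
qed

lemma prefix_of_comparable:
  "prefix_of xs X \<Longrightarrow> prefix_of ys X \<Longrightarrow> prefix xs ys \<or> prefix ys xs"
  using prefix_of_le[of xs X ys] prefix_of_le[of ys X xs] by linarith

section \<open>The uniform measure of cylinders and of clopen approximations\<close>

interpretation coins: product_prob_space "\<lambda>_. measure_pmf (pmf_of_set (UNIV :: bool set))" "UNIV :: nat set"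
  by unfold_locales

lemma prob_space_cantor: "prob_space cantor"
  unfolding cantor_def by (rule coins.prob_space_axioms)

interpretation cantor: prob_space cantor
  by (rule prob_space_cantor)

lemma space_cantor [simp]: "space cantor = UNIV"
  by (simp add: cantor_def space_PiM)

lemma cyl_eq_emb:
  "cyl xs = prod_emb UNIV (\<lambda>_. measure_pmf (pmf_of_set (UNIV :: bool set))) {..<length xs}
     (PiE {..<length xs} (\<lambda>i. {xs ! i}))"
  unfolding cyl_def prefix_of_def prod_emb_def vimage_def restrict_PiE_iff
  by (simp add: Ball_def)

lemma sets_cyl [measurable]: "cyl xs \<in> sets cantor"
  unfolding cyl_eq_emb cantor_def by (rule sets_PiM_I) auto

lemma measure_cyl: "measure cantor (cyl xs) = (1 / 2) ^ length xs"
proof -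
  have "measure cantor (cyl xs) =
      (\<Prod>i<length xs. measure (measure_pmf (pmf_of_set (UNIV :: bool set))) {xs ! i})"
    unfolding cyl_eq_emb cantor_def by (rule coins.measure_PiM_emb) auto
  also have "\<dots> = (\<Prod>i<length xs. 1 / 2)"
    by (rule prod.cong) (auto simp: measure_pmf_single)
  finally show ?thesis by simp
qed

lemma sets_UN_cyl [measurable]: "(\<Union>xs\<in>A. cyl xs) \<in> sets cantor"
  by (intro sets.countable_UN'') auto

lemma cyl_disjoint: "length xs = length ys \<Longrightarrow> xs \<noteq> ys \<Longrightarrow> cyl xs \<inter> cyl ys = {}"
  by (auto simp: cyl_def prefix_of_def list_eq_iff_nth_eq)

lemma finite_strings: "finite {xs :: bool list. P xs \<and> length xs = n}"
  by (rule finite_subset[OF _ finite_lists_length_eq[of UNIV n]]) auto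

text \<open>The clopen approximation at depth \<open>n\<close> to the open set generated by
  \<open>A\<close>; its measure is found by counting strings.\<close>

definition level :: "bool list set \<Rightarrow> nat \<Rightarrow> (nat \<Rightarrow> bool) set" where
  "level A n = {X. map X [0..<n] \<in> A}"

lemma level_eq_UN: "level A n = (\<Union>xs\<in>{xs. xs \<in> A \<and> length xs = n}. cyl xs)"
proof -
  have "X \<in> (\<Union>xs\<in>{xs. xs \<in> A \<and> length xs = n}. cyl xs) \<longleftrightarrow> map X [0..<n] \<in> A" for X
    by (auto simp: cyl_def prefix_of_iff_map)
  then show ?thesis unfolding level_def by blast
qed

lemma measure_level: "measure cantor (level A n) = card {xs. xs \<in> A \<and> length xs = n} / 2 ^ n"
proof -
  have "measure cantor (level A n) = (\<Sum>xs\<in>{xs. xs \<in> A \<and> length xs = n}. measure cantor (cyl xs))"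
    unfolding level_eq_UN
    by (rule cantor.finite_measure_finite_Union)
      (auto simp: finite_strings disjoint_family_on_def cyl_disjoint)
  also have "\<dots> = (\<Sum>xs\<in>{xs. xs \<in> A \<and> length xs = n}. (1 / 2) ^ n)"
    by (rule sum.cong) (auto simp: measure_cyl)
  finally show ?thesis by (simp add: field_simps)
qed

lemma incseq_level:
  assumes "\<And>xs ys. xs \<in> A \<Longrightarrow> prefix xs ys \<Longrightarrow> ys \<in> A"
  shows "incseq (level A)"
proof (rule incseq_SucI)
  have "map X [0..<Suc n] \<in> A" if "map X [0..<n] \<in> A" for X n
    by (rule assms[OF that]) simp
  then show "level A n \<subseteq> level A (Suc n)" for n by (auto simp only: level_def)
qed

lemma UN_level: "(\<Union>n. level A n) = (\<Union>xs\<in>A. cyl xs)"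
  unfolding level_eq_UN by auto

lemma level_limit:
  assumes "\<And>xs ys. xs \<in> A \<Longrightarrow> prefix xs ys \<Longrightarrow> ys \<in> A"
  shows "(\<lambda>n. measure cantor (level A n)) \<longlonglongrightarrow> measure cantor (\<Union>xs\<in>A. cyl xs)"
proof -
  have "range (level A) \<subseteq> sets cantor" by (auto simp: level_eq_UN)
  from cantor.finite_Lim_measure_incseq[OF this incseq_level[OF assms]]
  show ?thesis using UN_level by simp
qed

lemma level_le: "measure cantor (level A n) \<le> measure cantor (\<Union>xs\<in>A. cyl xs)"
  by (rule cantor.finite_measure_mono[OF _ sets_UN_cyl]) (auto simp: level_eq_UN)

section \<open>Topology of Cantor space\<close>

lemma open_cyl: "open (cyl xs)"
proof -
  have "cyl xs = (\<Inter>i<length xs. (\<lambda>X. X i) -` {xs ! i})"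
    by (auto simp: cyl_def prefix_of_def)
  moreover have "open ((\<lambda>X :: nat \<Rightarrow> bool. X i) -` {b})" for i b
    by (rule open_vimage[OF Topological_Spaces.open_discrete continuous_on_product_coordinates])
  then have "open (\<Inter>i<length xs. (\<lambda>X :: nat \<Rightarrow> bool. X i) -` {xs ! i})"
    by (intro open_INT) blast+
  ultimately show ?thesis by (simp only:)
qed

lemma compact_cantor: "compact (UNIV :: (nat \<Rightarrow> bool) set)"
proof -
  have "compact_space (product_topology (\<lambda>i::nat. euclidean :: bool topology) UNIV)"
    unfolding compact_space_product_topology
    by (auto simp: compact_space_def finite_imp_compact)
  then show ?thesis
    by (simp add: euclidean_product_topology compact_space_def)
qed

text \<open>By compactness an increasing cover has a finite subcover, which is contained in its
  largest member.\<close>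

lemma nested_open_cover:
  fixes U :: "nat \<Rightarrow> (nat \<Rightarrow> bool) set"
  assumes "\<And>n. open (U n)" "incseq U" "\<And>n. U n \<noteq> UNIV"
  shows "(\<Union>n. U n) \<noteq> UNIV"
proof
  assume "(\<Union>n. U n) = UNIV"
  then obtain F where F: "finite F" "UNIV \<subseteq> (\<Union>n\<in>F. U n)"
    using compactE_image[OF compact_cantor, of UNIV U] assms(1) by auto
  \<comment> \<open>Inserting 0 keeps the maximum meaningful when \<open>F\<close> is empty.\<close>
  have "U n \<subseteq> U (Max (insert 0 F))" if "n \<in> F" for n
    using incseqD[OF assms(2), of n "Max (insert 0 F)"] F(1) that by simp
  then have "(\<Union>n\<in>F. U n) \<subseteq> U (Max (insert 0 F))" by (rule UN_least)
  then show False using F(2) assms(3) by (metis top.extremum_unique subset_trans)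
qed

section \<open>Effectively open sets\<close>

definition str :: "nat \<Rightarrow> bool list" where
  "str = inv str_code"

lemma str_str_code [simp]: "str (str_code xs) = xs"
  by (simp add: str_def inj_str_code)

lemma str_code_str [simp]: "str_code (str c) = c"
  using surj_str_code[of c] by auto

lemma ex_str_iff: "(\<exists>xs. P xs) \<longleftrightarrow> (\<exists>c. P (str c))"
  by (metis str_str_code)

lemma dec_pred_prefix:
  "total_rec F \<Longrightarrow> total_rec G \<Longrightarrow> dec_pred (\<lambda>e. prefix (str (F e)) (str (G e)))"
  unfolding prefix_iff_str_code str_code_str
  by (intro dec_pred_bex dec_pred_conj dec_pred_le dec_pred_less dec_pred_eq total_rec_Suc total_rec_power
      total_rec_add total_rec_mult total_rec_proj total_rec_const total_rec_shift total_rec_shift2)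

lemma dec_pred_length_eq:
  "total_rec F \<Longrightarrow> total_rec G \<Longrightarrow> dec_pred (\<lambda>e. length (str (F e)) = G e)"
  unfolding length_eq_iff_str_code str_code_str
  by (intro dec_pred_conj dec_pred_le dec_pred_less total_rec_Suc total_rec_power total_rec_const)

lemma dec_pred_length_ge:
  assumes "total_rec F" "total_rec G"
  shows "dec_pred (\<lambda>e. G e \<le> length (str (F e)))"
proof -
  have "n \<le> length (str c) \<longleftrightarrow> \<not> (\<exists>m<n. length (str c) = m)" for n c by auto
  then show ?thesis
    by (simp only:) (intro dec_pred_not dec_pred_bex dec_pred_length_eq total_rec_proj total_rec_shift assms)
qed

lemma semirec_strpairs:
  assumes "ce_strpairs R" "total_rec F" "total_rec G"
  shows "semirec (\<lambda>e. (str (F e), str (G e)) \<in> R)"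
proof -
  have "(xs, ys) \<in> R \<longleftrightarrow>
      prod_encode (str_code xs, str_code ys) \<in> (\<lambda>(a, b). prod_encode (str_code a, str_code b)) ` R"
    for xs ys by (auto simp: prod_encode_eq image_iff Bex_def)
  then show ?thesis
    using assms unfolding ce_strpairs_def
    by (simp only: str_code_str) (intro semirec_ce_set total_rec_prod_encode)
qed

lemma semirec_natstr:
  assumes "ce_natstr R" "total_rec F" "total_rec G"
  shows "semirec (\<lambda>e. (F e, str (G e)) \<in> R)"
proof -
  have "(i, ys) \<in> R \<longleftrightarrow> prod_encode (i, str_code ys) \<in> (\<lambda>(i, b). prod_encode (i, str_code b)) ` R"
    for i ys by (auto simp: prod_encode_eq image_iff Bex_def)
  then show ?thesis
    using assms unfolding ce_natstr_def
    by (simp only: str_code_str) (intro semirec_ce_set total_rec_prod_encode)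
qed

lemma ce_natstrI:
  assumes "semirec (\<lambda>e. (e 0, str (e (Suc 0))) \<in> R)"
  shows "ce_natstr R"
  unfolding ce_natstr_def
proof (rule ce_set_semirec)
  have "x \<in> (\<lambda>(i, b). prod_encode (i, str_code b)) ` R \<longleftrightarrow>
      (\<exists>c i. x = prod_encode (i, c) \<and> (i, str c) \<in> R)" for x
  proof
    assume "\<exists>c i. x = prod_encode (i, c) \<and> (i, str c) \<in> R"
    then obtain c i where "x = prod_encode (i, c)" "(i, str c) \<in> R" by blast
    then show "x \<in> (\<lambda>(i, b). prod_encode (i, str_code b)) ` R"
      by (intro image_eqI[where x = "(i, str c)"]) simp_all
  qed (auto simp: image_iff)
  moreover have "semirec (\<lambda>e. \<exists>c i. e 0 = prod_encode (i, c) \<and> (i, str c) \<in> R)"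
  proof (intro semirec_ex semirec_conj)
    show "semirec (\<lambda>e. e (Suc (Suc 0)) = prod_encode (e 0, e (Suc 0)))"
      by (intro semirec_dec dec_pred_eq total_rec_prod_encode total_rec_proj)
  qed (rule assms)
  ultimately show "semirec (\<lambda>e. e 0 \<in> (\<lambda>(i, b). prod_encode (i, str_code b)) ` R)"
    by simp
qed

text \<open>Weakly 2-random sequences are Kurtz random: a test for the complement of an effectively
  open set of full measure is given by the clopen approximations to that complement.\<close>

lemma W2R_in_full_open:
  assumes X: "X \<in> W2R cantor" and A: "semirec (\<lambda>e. str (e 0) \<in> A)"
    and full: "measure cantor (\<Union>xs\<in>A. cyl xs) = 1"
  shows "X \<in> (\<Union>xs\<in>A. cyl xs)"
proof (rule ccontr)
  assume nin: "X \<notin> (\<Union>xs\<in>A. cyl xs)"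
  obtain R where R: "dec_pred R" "\<And>e. str (e 0) \<in> A \<longleftrightarrow> (\<exists>s. R (case_nat s e))"
    using A unfolding semirec_def by blast
  define T where "T c s = R (case_nat s (\<lambda>_. c))" for c s
  have T: "str c \<in> A \<longleftrightarrow> (\<exists>s. T c s)" for c
    using R(2)[of "\<lambda>_. c"] by (simp add: T_def)
  \<comment> \<open>A string of length \<open>i\<close> is kept while none of its prefixes has been
    enumerated into \<open>A\<close> before stage \<open>i\<close>. The bound on \<open>c\<close>
    loses nothing, as a prefix never has a larger code.\<close>
  define W where "W = {(i, xs). length xs = i \<and>
    (\<forall>c<Suc (str_code xs). \<forall>s<i. \<not> (prefix (str c) xs \<and> T c s))}"
  have "semirec (\<lambda>e. (e 0, str (e (Suc 0))) \<in> W)"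
    unfolding W_def mem_Collect_eq prod.case str_code_str T_def
    by (intro semirec_dec dec_pred_conj dec_pred_ball dec_pred_not dec_pred_length_eq dec_pred_prefix
        total_rec_proj total_rec_Suc dec_pred_subst[OF R(1)] total_rec_case_nat)
  then have ce: "ce_natstr W" by (rule ce_natstrI)
  have U: "Y \<in> eff_open W i \<longleftrightarrow> (\<forall>m\<le>i. \<forall>s<i. \<not> T (str_code (map Y [0..<m])) s)" for Y i
  proof -
    have "Y \<in> eff_open W i \<longleftrightarrow> (i, map Y [0..<i]) \<in> W"
      by (auto simp: eff_open_def cyl_def prefix_of_iff_map W_def)
    also have "\<dots> \<longleftrightarrow> (\<forall>xs. prefix xs (map Y [0..<i]) \<longrightarrow> (\<forall>s<i. \<not> T (str_code xs) s))"
    proof -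
      have le: "str_code xs \<le> str_code ys" if "prefix xs ys" for xs ys
        using that by (auto elim!: prefixE simp: str_code_append)
      show ?thesis unfolding W_def by (auto dest: le) (metis le less_Suc_eq_le str_str_code)
    qed
    also have "\<dots> \<longleftrightarrow> (\<forall>m\<le>i. \<forall>s<i. \<not> T (str_code (map Y [0..<m])) s)"
    proof -
      have "prefix xs (map Y [0..<i]) \<longleftrightarrow> (\<exists>m\<le>i. xs = map Y [0..<m])" for xs
      proof
        assume "prefix xs (map Y [0..<i])"
        then have "prefix_of xs Y" "length xs \<le> i"
          using prefix_of_prefix prefix_of_map prefix_length_le by fastforce+
        then show "\<exists>m\<le>i. xs = map Y [0..<m]" unfolding prefix_of_iff_map by metis
      next
        assume "\<exists>m\<le>i. xs = map Y [0..<m]"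
        then show "prefix xs (map Y [0..<i])" by (auto intro!: prefix_of_le prefix_of_map)
      qed
      then show ?thesis by auto
    qed
    finally show ?thesis .
  qed
  have dec: "decseq (eff_open W)"
    by (rule decseq_SucI) (auto simp: U)
  \<comment> \<open>The components shrink to exactly the complement of the open set generated by
    \<open>A\<close>, which is null.\<close>
  have notin: "Y \<notin> (\<Inter>i. eff_open W i) \<longleftrightarrow> Y \<in> (\<Union>xs\<in>A. cyl xs)" for Y
  proof
    assume "Y \<notin> (\<Inter>i. eff_open W i)"
    then obtain m s where "T (str_code (map Y [0..<m])) s" by (auto simp: U)
    then have "map Y [0..<m] \<in> A" using T[of "str_code (map Y [0..<m])"] by auto
    then show "Y \<in> (\<Union>xs\<in>A. cyl xs)" using prefix_of_map[of Y m] by (auto simp: cyl_def)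
  next
    assume "Y \<in> (\<Union>xs\<in>A. cyl xs)"
    then obtain xs where "xs \<in> A" "prefix_of xs Y" by (auto simp: cyl_def)
    then have "map Y [0..<length xs] \<in> A" by (simp add: prefix_of_iff_map)
    then obtain m where "map Y [0..<m] \<in> A" by blast
    then obtain s where "T (str_code (map Y [0..<m])) s"
      using T[of "str_code (map Y [0..<m])"] by auto
    moreover have "m \<le> m + Suc s" "s < m + Suc s" by auto
    ultimately have "Y \<notin> eff_open W (m + Suc s)" unfolding U by blast
    then show "Y \<notin> (\<Inter>i. eff_open W i)" by blast
  qed
  then have "(\<Inter>i. eff_open W i) = space cantor - (\<Union>xs\<in>A. cyl xs)" by auto
  then have "measure cantor (\<Inter>i. eff_open W i) = 0"
    using cantor.prob_compl[OF sets_UN_cyl] full by simp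
  moreover have "range (eff_open W) \<subseteq> sets cantor" by (auto simp: eff_open_def)
  ultimately have "(\<lambda>i. measure cantor (eff_open W i)) \<longlonglongrightarrow> 0"
    using cantor.finite_Lim_measure_decseq[OF _ dec] by simp
  then have "X \<notin> (\<Inter>i. eff_open W i)" using X ce unfolding W2R_def by blast
  then show False using notin nin by blast
qed

section \<open>Extension-closed sets of inputs generating the open sets of the argument\<close>

definition ext_strings :: "(bool list \<times> bool list) set \<Rightarrow> bool list \<Rightarrow> bool list set" where
  "ext_strings \<Phi> \<tau> = {xs. \<exists>\<alpha> \<rho>. (\<alpha>, \<rho>) \<in> \<Phi> \<and> prefix \<alpha> xs \<and> prefix \<tau> \<rho>}"

definition inc_strings :: "(bool list \<times> bool list) set \<Rightarrow> bool list \<Rightarrow> bool list set" where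
  "inc_strings \<Phi> \<tau> = {xs. \<exists>\<alpha> \<rho>. (\<alpha>, \<rho>) \<in> \<Phi> \<and> prefix \<alpha> xs \<and> \<not> prefix \<tau> \<rho> \<and> \<not> prefix \<rho> \<tau>}"

definition test_strings :: "(nat \<times> bool list) set \<Rightarrow> nat \<Rightarrow> bool list set" where
  "test_strings W i = {xs. \<exists>\<alpha>. (i, \<alpha>) \<in> W \<and> prefix \<alpha> xs}"

definition phi_inc :: "(bool list \<times> bool list) set \<Rightarrow> (nat \<Rightarrow> bool) \<Rightarrow> bool list \<Rightarrow> bool" where
  "phi_inc \<Phi> X \<tau> \<longleftrightarrow> (\<exists>\<rho>\<in>outs \<Phi> X. \<not> prefix \<tau> \<rho> \<and> \<not> prefix \<rho> \<tau>)"

lemma UN_ext_strings: "(\<Union>xs\<in>ext_strings \<Phi> \<tau>. cyl xs) = {X. phi_ext \<Phi> X \<tau>}"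
  unfolding ext_strings_def phi_ext_def outs_def cyl_def by (auto dest: prefix_of_prefix)

lemma UN_inc_strings: "(\<Union>xs\<in>inc_strings \<Phi> \<tau>. cyl xs) = {X. phi_inc \<Phi> X \<tau>}"
  unfolding inc_strings_def phi_inc_def outs_def cyl_def by (auto dest: prefix_of_prefix)

lemma UN_test_ext_strings:
  "(\<Union>xs\<in>test_strings W i \<inter> ext_strings \<Phi> \<tau>. cyl xs) = eff_open W i \<inter> {X. phi_ext \<Phi> X \<tau>}"
proof (intro equalityI subsetI)
  fix X assume "X \<in> eff_open W i \<inter> {X. phi_ext \<Phi> X \<tau>}"
  then obtain \<beta> \<alpha> \<rho> where *: "(i, \<beta>) \<in> W" "prefix_of \<beta> X" "(\<alpha>, \<rho>) \<in> \<Phi>" "prefix_of \<alpha> X" "prefix \<tau> \<rho>"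
    unfolding eff_open_def phi_ext_def outs_def cyl_def by auto
  \<comment> \<open>An initial segment of \<open>X\<close> long enough to extend both witnessing
    strings.\<close>
  let ?xs = "map X [0..<max (length \<alpha>) (length \<beta>)]"
  have "prefix \<alpha> ?xs" "prefix \<beta> ?xs" using * by (auto intro!: prefix_of_le prefix_of_map)
  then have "?xs \<in> test_strings W i \<inter> ext_strings \<Phi> \<tau>"
    using * unfolding test_strings_def ext_strings_def by blast
  then show "X \<in> (\<Union>xs\<in>test_strings W i \<inter> ext_strings \<Phi> \<tau>. cyl xs)"
    using prefix_of_map unfolding cyl_def by blast
next
  fix X assume "X \<in> (\<Union>xs\<in>test_strings W i \<inter> ext_strings \<Phi> \<tau>. cyl xs)"
  then show "X \<in> eff_open W i \<inter> {X. phi_ext \<Phi> X \<tau>}"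
    unfolding eff_open_def phi_ext_def outs_def cyl_def test_strings_def ext_strings_def
    by (auto dest: prefix_of_prefix)
qed

text \<open>Brings the count of strings into the form of a bounded count of numbers, as
  \<open>semirec_card_ge\<close> expects.\<close>

lemma card_strings_eq_card_codes:
  "card {xs. xs \<in> A \<and> length xs = n} = card {c. c < 2 ^ Suc n \<and> (str c \<in> A \<and> length (str c) = n)}"
proof (rule bij_betw_same_card[of str_code])
  have "str_code xs < 2 ^ Suc (length xs)" for xs using str_code_bounds[of xs] by linarith
  then show "bij_betw str_code {xs. xs \<in> A \<and> length xs = n}
      {c. c < 2 ^ Suc n \<and> (str c \<in> A \<and> length (str c) = n)}"
    by (intro bij_betwI[where g = str]) auto
qed

lemma semirec_test_ext_strings:
  assumes "ce_strpairs \<Phi>" "ce_natstr W" "total_rec F" "total_rec G" "total_rec H"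
  shows "semirec (\<lambda>e. str (F e) \<in> test_strings W (G e) \<inter> ext_strings \<Phi> (str (H e)))"
proof -
  have "semirec (\<lambda>e. (\<exists>a. (e (Suc 0), str a) \<in> W \<and> prefix (str a) (str (e 0))) \<and>
     (\<exists>a r. (str a, str r) \<in> \<Phi> \<and> prefix (str a) (str (e 0)) \<and> prefix (str (e (Suc (Suc 0)))) (str r)))"
    by (intro semirec_ex semirec_conj semirec_strpairs semirec_natstr assms(1,2) semirec_dec
        dec_pred_prefix total_rec_proj)
  then have "semirec (\<lambda>e. str (e 0) \<in> test_strings W (e (Suc 0)) \<inter> ext_strings \<Phi> (str (e (Suc (Suc 0)))))"
    unfolding test_strings_def ext_strings_def Int_iff mem_Collect_eq
    by (subst (1 2 3) ex_str_iff) simp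
  from semirec_subst[OF this, where E = "\<lambda>e. case_nat (F e) (case_nat (G e) (case_nat (H e) e))"]
  show ?thesis using assms by (simp add: total_rec_case_nat total_rec_proj)
qed

lemma semirec_inc_strings:
  assumes "ce_strpairs \<Phi>" "total_rec F" "total_rec H"
  shows "semirec (\<lambda>e. str (F e) \<in> inc_strings \<Phi> (str (H e)))"
proof -
  have "semirec (\<lambda>e. \<exists>a r. (str a, str r) \<in> \<Phi> \<and> prefix (str a) (str (e 0)) \<and>
      \<not> prefix (str (e (Suc 0))) (str r) \<and> \<not> prefix (str r) (str (e (Suc 0))))"
    by (intro semirec_ex semirec_conj[OF semirec_strpairs] assms(1) semirec_dec
        dec_pred_conj dec_pred_not dec_pred_prefix total_rec_proj)
  then have "semirec (\<lambda>e. str (e 0) \<in> inc_strings \<Phi> (str (e (Suc 0))))"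
    unfolding inc_strings_def mem_Collect_eq
    by (subst (1 2) ex_str_iff) simp
  from semirec_subst[OF this, where E = "\<lambda>e. case_nat (F e) (case_nat (H e) e)"]
  show ?thesis using assms by (simp add: total_rec_case_nat total_rec_proj)
qed

section \<open>Turing functionals\<close>

lemma outs_comparable:
  assumes "turing_functional \<Phi>" "\<rho> \<in> outs \<Phi> X" "\<rho>' \<in> outs \<Phi> X"
  shows "prefix \<rho> \<rho>' \<or> prefix \<rho>' \<rho>"
proof -
  obtain \<alpha> \<alpha>' where *: "(\<alpha>, \<rho>) \<in> \<Phi>" "prefix_of \<alpha> X" "(\<alpha>', \<rho>') \<in> \<Phi>" "prefix_of \<alpha>' X"
    using assms(2,3) unfolding outs_def by blast
  then have "prefix \<alpha> \<alpha>' \<or> prefix \<alpha>' \<alpha>" using prefix_of_comparable by blast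
  then show ?thesis using * assms(1) unfolding turing_functional_def by blast
qed

lemma phi_ext_not_phi_inc:
  assumes "turing_functional \<Phi>" "phi_ext \<Phi> X \<tau>"
  shows "\<not> phi_inc \<Phi> X \<tau>"
proof
  assume "phi_inc \<Phi> X \<tau>"
  then obtain \<rho>' where \<rho>': "\<rho>' \<in> outs \<Phi> X" "\<not> prefix \<tau> \<rho>'" "\<not> prefix \<rho>' \<tau>"
    unfolding phi_inc_def by blast
  obtain \<rho> where \<rho>: "\<rho> \<in> outs \<Phi> X" "prefix \<tau> \<rho>" using assms(2) unfolding phi_ext_def by blast
  from outs_comparable[OF assms(1) \<rho>(1) \<rho>'(1)] show False
    using \<rho>(2) \<rho>'(2,3) prefix_order.trans prefix_same_cases by blast
qed

lemma phi_ext_unique: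
  assumes "turing_functional \<Phi>" "phi_ext \<Phi> X \<tau>" "phi_ext \<Phi> X \<tau>'"
  shows "prefix \<tau> \<tau>' \<or> prefix \<tau>' \<tau>"
proof -
  obtain \<rho> \<rho>' where \<rho>: "\<rho> \<in> outs \<Phi> X" "prefix \<tau> \<rho>" "\<rho>' \<in> outs \<Phi> X" "prefix \<tau>' \<rho>'"
    using assms(2,3) unfolding phi_ext_def by blast
  from outs_comparable[OF assms(1) \<rho>(1,3)] show ?thesis
    using \<rho>(2,4) prefix_order.trans prefix_same_cases by blast
qed

lemma phi_dom_ext_or_inc:
  assumes "X \<in> phi_dom \<Phi>"
  shows "phi_ext \<Phi> X \<tau> \<or> phi_inc \<Phi> X \<tau>"
proof -
  obtain \<rho> where \<rho>: "\<rho> \<in> outs \<Phi> X" "length \<tau> \<le> length \<rho>"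
    using assms unfolding phi_dom_def by blast
  have "prefix \<tau> \<rho>" if "prefix \<rho> \<tau>"
    using that \<rho>(2) by (auto simp: prefix_def)
  then show ?thesis using \<rho>(1) unfolding phi_ext_def phi_inc_def by blast
qed

text \<open>This makes the open sets of incompatible oracles increase along the prefixes of
  \<open>Y\<close>, as the compactness argument requires.\<close>

lemma phi_inc_prefix:
  assumes "phi_inc \<Phi> X \<tau>" "prefix \<tau> \<tau>'"
  shows "phi_inc \<Phi> X \<tau>'"
  using assms unfolding phi_inc_def by (meson prefix_order.trans prefix_same_cases)

lemma sets_phi_ext [measurable]: "{X. phi_ext \<Phi> X \<tau>} \<in> sets cantor"
  by (simp flip: UN_ext_strings)

lemma sets_phi_inc [measurable]: "{X. phi_inc \<Phi> X \<tau>} \<in> sets cantor"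
  by (simp flip: UN_inc_strings)

lemma sets_eff_open [measurable]: "eff_open W i \<in> sets cantor"
  by (simp add: eff_open_def)

text \<open>The two events are disjoint and together cover the domain, which has measure 1. As both
  are effectively open, the measure of the preimage can be approximated from either side.\<close>

lemma measure_phi_ext:
  assumes "turing_functional \<Phi>" "almost_total \<Phi>"
  shows "measure cantor {X. phi_ext \<Phi> X \<tau>} = 1 - measure cantor {X. phi_inc \<Phi> X \<tau>}"
proof -
  have "1 \<le> measure cantor ({X. phi_ext \<Phi> X \<tau>} \<union> {X. phi_inc \<Phi> X \<tau>})"
    using cantor.finite_measure_mono[of "phi_dom \<Phi>" "{X. phi_ext \<Phi> X \<tau>} \<union> {X. phi_inc \<Phi> X \<tau>}"]
      assms(2) phi_dom_ext_or_inc unfolding almost_total_def by fastforce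
  moreover have "measure cantor ({X. phi_ext \<Phi> X \<tau>} \<union> {X. phi_inc \<Phi> X \<tau>}) =
      measure cantor {X. phi_ext \<Phi> X \<tau>} + measure cantor {X. phi_inc \<Phi> X \<tau>}"
    by (rule cantor.finite_measure_Union) (use phi_ext_not_phi_inc[OF assms(1)] in auto)
  ultimately show ?thesis
    using cantor.prob_le_1[of "{X. phi_ext \<Phi> X \<tau>} \<union> {X. phi_inc \<Phi> X \<tau>}"] by linarith
qed

section \<open>The density test: enumerability and measure bound\<close>

definition density_test ::
  "(bool list \<times> bool list) set \<Rightarrow> (nat \<times> bool list) set \<Rightarrow> nat \<Rightarrow> (nat \<times> bool list) set" where
  "density_test \<Phi> W k = {(i, \<tau>). measure cantor {X. phi_ext \<Phi> X \<tau>} <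
     2 ^ k * measure cantor (eff_open W i \<inter> {X. phi_ext \<Phi> X \<tau>})}"

text \<open>Rewriting the measure of the preimage as one minus that of the incompatible oracles puts
  increasing quantities on one side only, to be compared with 1. A strict inequality for the limit
  already holds at a finite depth \<open>n\<close>, where multiplication by \<open>2 ^ n\<close>
  leaves integers.\<close>

lemma density_test_iff:
  assumes "turing_functional \<Phi>" "almost_total \<Phi>"
  shows "(i, \<tau>) \<in> density_test \<Phi> W k \<longleftrightarrow>
    (\<exists>n. 2 ^ n < 2 ^ k * card {xs. xs \<in> test_strings W i \<inter> ext_strings \<Phi> \<tau> \<and> length xs = n}
               + card {xs. xs \<in> inc_strings \<Phi> \<tau> \<and> length xs = n})"
proof -
  let ?A = "test_strings W i \<inter> ext_strings \<Phi> \<tau>" and ?B = "inc_strings \<Phi> \<tau>"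
  let ?f = "\<lambda>n. 2 ^ k * measure cantor (level ?A n) + measure cantor (level ?B n)"
  let ?l = "2 ^ k * measure cantor (\<Union>xs\<in>?A. cyl xs) + measure cantor (\<Union>xs\<in>?B. cyl xs)"
  have "ys \<in> ?A" if "xs \<in> ?A" "prefix xs ys" for xs ys
    using that prefix_order.trans unfolding test_strings_def ext_strings_def by blast
  moreover have "ys \<in> ?B" if "xs \<in> ?B" "prefix xs ys" for xs ys
    using that prefix_order.trans unfolding inc_strings_def by blast
  ultimately have lim: "?f \<longlonglongrightarrow> ?l"
    by (intro tendsto_add tendsto_mult tendsto_const level_limit) blast+
  have le: "?f n \<le> ?l" for n by (intro add_mono mult_left_mono level_le) auto
  have f: "1 < ?f n \<longleftrightarrow> 2 ^ n < 2 ^ k * card {xs. xs \<in> ?A \<and> length xs = n}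
      + card {xs. xs \<in> ?B \<and> length xs = n}" (is "_ \<longleftrightarrow> _ < _ * ?a + ?b") for n
  proof -
    have "1 < ?f n \<longleftrightarrow> (2::real) ^ n < 2 ^ k * real ?a + real ?b"
      unfolding measure_level by (simp add: field_simps)
    also have "\<dots> \<longleftrightarrow> real (2 ^ n) < real (2 ^ k * ?a + ?b)" by simp
    also have "\<dots> \<longleftrightarrow> 2 ^ n < 2 ^ k * ?a + ?b" by (rule of_nat_less_iff)
    finally show ?thesis .
  qed
  have "(i, \<tau>) \<in> density_test \<Phi> W k \<longleftrightarrow> 1 < ?l"
    unfolding density_test_def UN_test_ext_strings UN_inc_strings mem_Collect_eq prod.case
      measure_phi_ext[OF assms] by linarith
  also have "\<dots> \<longleftrightarrow> (\<exists>n. 1 < ?f n)"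
  proof
    assume "1 < ?l"
    from order_tendstoD(1)[OF lim this] show "\<exists>n. 1 < ?f n" by (auto simp: eventually_sequentially)
  qed (use le order_less_le_trans in blast)
  finally show ?thesis unfolding f .
qed

lemma ce_density_test:
  assumes "turing_functional \<Phi>" "almost_total \<Phi>" "ce_natstr W"
  shows "ce_natstr (density_test \<Phi> W k)"
proof (rule ce_natstrI)
  have \<Phi>: "ce_strpairs \<Phi>" using assms(1) by (simp add: turing_functional_def)
  \<comment> \<open>Only lower bounds on the two cardinalities are enumerable; they are guessed as
    \<open>a\<close> and \<open>b\<close>, and the inequality is monotone in both.\<close>
  have "semirec (\<lambda>e. \<exists>n a b.
      a \<le> card {c. c < 2 ^ Suc n \<and> (str c \<in> test_strings W (e 0) \<inter> ext_strings \<Phi> (str (e (Suc 0)))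
        \<and> length (str c) = n)} \<and>
      b \<le> card {c. c < 2 ^ Suc n \<and> (str c \<in> inc_strings \<Phi> (str (e (Suc 0))) \<and> length (str c) = n)} \<and>
      2 ^ n < 2 ^ k * a + b)"
    by (intro semirec_ex semirec_conj semirec_card_ge total_rec_proj total_rec_power total_rec_Suc
        total_rec_const semirec_dec[OF dec_pred_length_eq] semirec_dec[OF dec_pred_less]
        semirec_inc_strings[OF \<Phi>] semirec_test_ext_strings[OF \<Phi> assms(3)] total_rec_add total_rec_mult)
  moreover have "(\<exists>a b. a \<le> x \<and> b \<le> y \<and> m < 2 ^ k * a + b) \<longleftrightarrow> m < 2 ^ k * x + y" for m x y :: nat
    by (meson add_mono mult_le_mono2 order_less_le_trans order_refl)
  ultimately show "semirec (\<lambda>e. (e 0, str (e (Suc 0))) \<in> density_test \<Phi> W k)"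
    unfolding density_test_iff[OF assms(1,2)] card_strings_eq_card_codes by simp
qed

text \<open>Ville's maximal inequality: on the prefix-minimal strings of the test, which generate the
  same open set, the cylinders and their preimages are pairwise disjoint.\<close>

lemma measure_density_test:
  assumes "turing_functional \<Phi>" and sets: "sets \<mu> = sets cantor"
    and \<mu>: "\<And>\<sigma>. emeasure \<mu> (cyl \<sigma>) = emeasure cantor {X. phi_ext \<Phi> X \<sigma>}"
  shows "measure \<mu> (eff_open (density_test \<Phi> W k) i) \<le> 2 ^ k * measure cantor (eff_open W i)"
proof -
  let ?E = "\<lambda>\<tau>. {X. phi_ext \<Phi> X \<tau>}"
  define S where "S = {\<tau>. (i, \<tau>) \<in> density_test \<Phi> W k}"
  define M where "M = {\<tau> \<in> S. \<forall>\<tau>'. strict_prefix \<tau>' \<tau> \<longrightarrow> \<tau>' \<notin> S}"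
  have min: "\<exists>\<tau>'\<in>M. prefix \<tau>' \<tau>" if "\<tau> \<in> S" for \<tau>
    using that
  proof (induction "length \<tau>" arbitrary: \<tau> rule: less_induct)
    case less
    show ?case
    proof (cases "\<tau> \<in> M")
      case False
      then obtain \<tau>' where "strict_prefix \<tau>' \<tau>" "\<tau>' \<in> S" using less.prems unfolding M_def by blast
      then show ?thesis
        using less.hyps prefix_length_less prefix_order.trans prefix_order.less_imp_le by metis
    qed auto
  qed
  have incomp: "\<not> prefix \<tau> \<tau>'" if "\<tau> \<in> M" "\<tau>' \<in> M" "\<tau> \<noteq> \<tau>'" for \<tau> \<tau>'
    using that unfolding M_def by (auto simp: strict_prefix_def)
  have "eff_open (density_test \<Phi> W k) i = (\<Union>\<tau>\<in>M. cyl \<tau>)"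
  proof
    show "eff_open (density_test \<Phi> W k) i \<subseteq> (\<Union>\<tau>\<in>M. cyl \<tau>)"
      using min prefix_of_prefix unfolding eff_open_def S_def[symmetric] cyl_def by blast
  qed (auto simp: eff_open_def M_def S_def)
  then have "emeasure \<mu> (eff_open (density_test \<Phi> W k) i) = emeasure \<mu> (\<Union>\<tau>\<in>M. cyl \<tau>)" by simp
  also have "\<dots> = (\<integral>\<^sup>+\<tau>. emeasure \<mu> (cyl \<tau>) \<partial>count_space M)"
  proof (rule emeasure_UN_countable)
    show "disjoint_family_on cyl M"
      unfolding disjoint_family_on_def cyl_def using incomp prefix_of_comparable by blast
  qed (auto simp: sets)
  \<comment> \<open>The defining inequality of the test, applied termwise, replaces the mass of each
    cylinder by mass of the given open set inside the preimage.\<close>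
  also have "\<dots> \<le> (\<integral>\<^sup>+\<tau>. ennreal (2 ^ k) * emeasure cantor (eff_open W i \<inter> ?E \<tau>) \<partial>count_space M)"
  proof (rule nn_integral_mono)
    fix \<tau> assume "\<tau> \<in> space (count_space M)"
    then have "measure cantor (?E \<tau>) \<le> 2 ^ k * measure cantor (eff_open W i \<inter> ?E \<tau>)"
      unfolding M_def S_def density_test_def by auto
    then show "emeasure \<mu> (cyl \<tau>) \<le> ennreal (2 ^ k) * emeasure cantor (eff_open W i \<inter> ?E \<tau>)"
      unfolding \<mu> cantor.emeasure_eq_measure by (simp flip: ennreal_mult)
  qed
  also have "\<dots> = ennreal (2 ^ k) * (\<integral>\<^sup>+\<tau>. emeasure cantor (eff_open W i \<inter> ?E \<tau>) \<partial>count_space M)"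
    by (rule nn_integral_cmult) simp
  also have "(\<integral>\<^sup>+\<tau>. emeasure cantor (eff_open W i \<inter> ?E \<tau>) \<partial>count_space M) =
      emeasure cantor (\<Union>\<tau>\<in>M. eff_open W i \<inter> ?E \<tau>)"
  proof (rule emeasure_UN_countable[symmetric])
    show "disjoint_family_on (\<lambda>\<tau>. eff_open W i \<inter> ?E \<tau>) M"
      unfolding disjoint_family_on_def using incomp phi_ext_unique[OF assms(1)] by blast
  qed auto
  also have "\<dots> \<le> emeasure cantor (eff_open W i)"
    by (rule emeasure_mono) auto
  finally have "emeasure \<mu> (eff_open (density_test \<Phi> W k) i) \<le>
      ennreal (2 ^ k * measure cantor (eff_open W i))"
    by (simp add: cantor.emeasure_eq_measure ennreal_mult mult_left_mono)
  then show ?thesis by (simp add: measure_def enn2real_leI)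
qed

text \<open>The measure bound squeezes the density test to zero, so \<open>Y\<close> avoids one of
  its components; failing the test at all prefixes of \<open>Y\<close> is the claimed
  inequality.\<close>

lemma W2R_density_bound:
  assumes "turing_functional \<Phi>" "almost_total \<Phi>" "sets \<mu> = sets cantor"
    and "\<And>\<sigma>. emeasure \<mu> (cyl \<sigma>) = emeasure cantor {X. phi_ext \<Phi> X \<sigma>}"
    and "Y \<in> W2R \<mu>" "ce_natstr W" "(\<lambda>i. measure cantor (eff_open W i)) \<longlonglongrightarrow> 0"
  shows "\<exists>i. \<forall>\<tau>. prefix_of \<tau> Y \<longrightarrow>
    2 ^ k * measure cantor (eff_open W i \<inter> {X. phi_ext \<Phi> X \<tau>}) \<le> measure cantor {X. phi_ext \<Phi> X \<tau>}"
proof -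
  have "(\<lambda>i. 2 ^ k * measure cantor (eff_open W i)) \<longlonglongrightarrow> 0"
    using tendsto_mult_right_zero[OF assms(7)] by simp
  then have "(\<lambda>i. measure \<mu> (eff_open (density_test \<Phi> W k) i)) \<longlonglongrightarrow> 0"
    by (rule tendsto_sandwich[OF always_eventually always_eventually tendsto_const, rotated 2])
      (auto intro: measure_density_test[OF assms(1,3,4)])
  with ce_density_test[OF assms(1,2,6)] assms(5) have "Y \<notin> (\<Inter>i. eff_open (density_test \<Phi> W k) i)"
    unfolding W2R_def by blast
  then obtain i where "Y \<notin> eff_open (density_test \<Phi> W k) i" by blast
  then have "(i, \<tau>) \<notin> density_test \<Phi> W k" if "prefix_of \<tau> Y" for \<tau>
    using that unfolding eff_open_def cyl_def by blast
  then show ?thesis by (auto simp: density_test_def not_less)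
qed

text \<open>A null cylinder around \<open>Y\<close>, repeated constantly, would be a test capturing
  \<open>Y\<close>. Positivity is what later makes "at most half" strictly less than the
  whole.\<close>

lemma W2R_prefix_pos:
  assumes "Y \<in> W2R \<mu>" "prefix_of xs Y"
  shows "0 < measure \<mu> (cyl xs)"
proof (rule ccontr)
  assume "\<not> 0 < measure \<mu> (cyl xs)"
  then have 0: "measure \<mu> (cyl xs) = 0" by (simp add: zero_less_measure_iff)
  define W where "W = {(i :: nat, ys). ys = xs}"
  have W: "eff_open W i = cyl xs" for i by (auto simp: eff_open_def W_def)
  have "str c = xs \<longleftrightarrow> c = str_code xs" for c by auto
  then have "semirec (\<lambda>e. (e 0, str (e (Suc 0))) \<in> W)"
    unfolding W_def mem_Collect_eq prod.case
    by (simp only:) (intro semirec_dec dec_pred_eq total_rec_proj total_rec_const)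
  then have "ce_natstr W" by (rule ce_natstrI)
  moreover have "(\<lambda>i. measure \<mu> (eff_open W i)) \<longlonglongrightarrow> 0" by (simp add: W 0)
  moreover have "Y \<in> (\<Inter>i. eff_open W i)" using assms(2) by (simp add: W cyl_def)
  ultimately show False using assms(1) unfolding W2R_def by blast
qed

text \<open>For each \<open>n\<close>, the oracles with an output of length at least
  \<open>n\<close> form an effectively open set containing the domain, hence of full
  measure.\<close>

lemma W2R_phi_dom:
  assumes "turing_functional \<Phi>" "almost_total \<Phi>" "X \<in> W2R cantor"
  shows "X \<in> phi_dom \<Phi>"
  unfolding phi_dom_def mem_Collect_eq
proof
  fix n
  define A where "A = {\<alpha>. \<exists>\<rho>. (\<alpha>, \<rho>) \<in> \<Phi> \<and> n \<le> length \<rho>}"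
  have \<Phi>: "ce_strpairs \<Phi>" using assms(1) by (simp add: turing_functional_def)
  have "semirec (\<lambda>e. \<exists>c. (str (e 0), str c) \<in> \<Phi> \<and> n \<le> length (str c))"
    by (intro semirec_ex semirec_conj semirec_strpairs \<Phi> total_rec_proj semirec_dec
        dec_pred_length_ge total_rec_const)
  then have ce: "semirec (\<lambda>e. str (e 0) \<in> A)"
    unfolding A_def mem_Collect_eq by (subst ex_str_iff)
  have A: "Z' \<in> (\<Union>xs\<in>A. cyl xs) \<longleftrightarrow> (\<exists>\<tau>\<in>outs \<Phi> Z'. n \<le> length \<tau>)" for Z'
    unfolding A_def outs_def cyl_def by blast
  have "phi_dom \<Phi> \<subseteq> (\<Union>xs\<in>A. cyl xs)"
    unfolding phi_dom_def using A by blast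
  then have "1 \<le> measure cantor (\<Union>xs\<in>A. cyl xs)"
    using assms(2) cantor.finite_measure_mono[OF _ sets_UN_cyl] unfolding almost_total_def by metis
  then have "measure cantor (\<Union>xs\<in>A. cyl xs) = 1"
    using cantor.prob_le_1 by (meson order_antisym)
  from W2R_in_full_open[OF assms(3) ce this] show "\<exists>\<tau>\<in>outs \<Phi> X. n \<le> length \<tau>"
    unfolding A .
qed

text \<open>An output longer than \<open>n\<close> and compatible with the first
  \<open>n + 1\<close> bits of \<open>Y\<close> has the bit \<open>Y n\<close> at position
  \<open>n\<close>; the domain supplies such outputs.\<close>

lemma phi_apply_eqI:
  assumes "X \<in> phi_dom \<Phi>" "\<And>n. \<not> phi_inc \<Phi> X (map Y [0..<n])"
  shows "phi_apply \<Phi> X = Y"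
proof
  fix n
  have val: "\<tau> ! n = Y n" if "\<tau> \<in> outs \<Phi> X" "n < length \<tau>" for \<tau>
  proof -
    have "prefix (map Y [0..<Suc n]) \<tau> \<or> prefix \<tau> (map Y [0..<Suc n])"
      using assms(2) that(1) unfolding phi_inc_def by blast
    moreover have "xs ! n = ys ! n" if "prefix xs ys" "n < length xs" for xs ys :: "bool list"
      using that by (auto simp: prefix_def nth_append)
    ultimately have "\<tau> ! n = map Y [0..<Suc n] ! n"
      using that(2) by (metis length_map length_upt diff_zero lessI)
    then show ?thesis by (simp del: upt_Suc)
  qed
  obtain \<tau> where "\<tau> \<in> outs \<Phi> X" "n < length \<tau>"
    using assms(1) unfolding phi_dom_def by (auto simp: Suc_le_eq dest: spec[of _ "Suc n"])
  with val show "phi_apply \<Phi> X n = Y n"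
    unfolding phi_apply_def by (intro the_equality) blast+
qed

section \<open>Countability of the tests and construction of the preimage\<close>

instance recf :: countable
  by countable_datatype

text \<open>An enumerable set is determined by a program, and programs are finite trees over the
  naturals.\<close>

lemma countable_ce_natstr: "countable {W. ce_natstr W}"
proof -
  let ?enc = "\<lambda>(i, b). prod_encode (i, str_code b)"
  have "inj ?enc" by (auto simp: inj_def prod_encode_eq)
  then have "inj_on ((`) ?enc) {W. ce_natstr W}"
    by (meson inj_image_eq_iff inj_onI)
  moreover have "(`) ?enc ` {W. ce_natstr W} \<subseteq> range (\<lambda>f. {n. \<exists>v. eval f [n] v})"
  proof (clarify)
    fix W assume "ce_natstr W"
    then obtain f where "\<And>n. n \<in> ?enc ` W \<longleftrightarrow> (\<exists>v. eval f [n] v)"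
      unfolding ce_natstr_def ce_set_def by blast
    then have "?enc ` W = {n. \<exists>v. eval f [n] v}" by blast
    then show "?enc ` W \<in> range (\<lambda>f. {n. \<exists>v. eval f [n] v})" by blast
  qed
  then have "countable ((`) ?enc ` {W. ce_natstr W})"
    by (rule countable_subset) simp
  ultimately show ?thesis by (rule countable_image_inj_on[rotated])
qed

text \<open>The induced measure is given as a measure \<open>\<mu>\<close> on the product
  sigma-algebra with the prescribed values on cylinders.\<close>

theorem theorem6p18:
  fixes \<Phi> :: "(bool list \<times> bool list) set"
    and \<mu> :: "(nat \<Rightarrow> bool) measure"
    and Y :: "nat \<Rightarrow> bool"
  assumes "turing_functional \<Phi>"
    and "almost_total \<Phi>"
    and "sets \<mu> = sets cantor"
    and "\<And>\<sigma>. emeasure \<mu> (cyl \<sigma>) = emeasure cantor {X. phi_ext \<Phi> X \<sigma>}"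
    and "Y \<in> W2R \<mu>"
  shows "\<exists>X. X \<in> W2R cantor \<and> X \<in> phi_dom \<Phi> \<and> phi_apply \<Phi> X = Y"
proof -
  let ?E = "\<lambda>n. {X. phi_ext \<Phi> X (map Y [0..<n])}"
  define tests where "tests = {W. ce_natstr W \<and> (\<lambda>i. measure cantor (eff_open W i)) \<longlonglongrightarrow> 0}"
  have "countable tests"
    unfolding tests_def by (rule countable_subset[OF _ countable_ce_natstr]) auto
  then obtain T :: "nat \<Rightarrow> (nat \<times> bool list) set" where T: "tests \<subseteq> range T"
    by (metis empty_subsetI range_from_nat_into subset_refl)
  \<comment> \<open>The enumeration may also list sets that are not tests; the empty set replaces
    them and contributes nothing to \<open>G\<close>.\<close>
  define W where "W k = (if T k \<in> tests then T k else {})" for k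
  have "\<exists>i. \<forall>n. 2 ^ (k + 2) * measure cantor (eff_open (W k) i \<inter> ?E n) \<le> measure cantor (?E n)" for k
  proof (cases "T k \<in> tests")
    case True
    then show ?thesis
      using W2R_density_bound[OF assms, of "T k" "k + 2"] prefix_of_map
      unfolding W_def tests_def by auto
  next
    case False
    then show ?thesis by (simp add: W_def eff_open_def)
  qed
  then obtain idx where idx: "\<And>k n. 2 ^ (k + 2) *
      measure cantor (eff_open (W k) (idx k) \<inter> ?E n) \<le> measure cantor (?E n)" by metis
  define G where "G = (\<Union>k. eff_open (W k) (idx k))"
  \<comment> \<open>The fractions \<open>2 ^ -(k + 2)\<close> sum to one half, so \<open>G\<close>
    cannot cover the preimage of the first \<open>n\<close> bits of \<open>Y\<close>, and no point
    of this preimage has an incompatible output.\<close>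
  have ne: "G \<union> {X. phi_inc \<Phi> X (map Y [0..<n])} \<noteq> UNIV" for n
  proof -
    let ?m = "measure cantor (?E n)"
    have "measure \<mu> (cyl (map Y [0..<n])) = ?m" unfolding measure_def assms(4) ..
    then have pos: "0 < ?m" using W2R_prefix_pos[OF assms(5) prefix_of_map] by metis
    have le: "measure cantor (eff_open (W k) (idx k) \<inter> ?E n) \<le> (1 / 2) ^ Suc k * (?m / 2)" for k
      using idx[of k n] by (simp add: field_simps)
    have sums: "(\<lambda>k. (1 / 2) ^ Suc k * (?m / 2)) sums (1 * (?m / 2))"
      by (rule sums_mult2[OF power_half_series])
    have summable: "summable (\<lambda>k. measure cantor (eff_open (W k) (idx k) \<inter> ?E n))"
      by (rule summable_comparison_test'[OF sums_summable[OF sums]]) (use le in auto)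
    have "measure cantor (\<Union>k. eff_open (W k) (idx k) \<inter> ?E n) \<le>
        (\<Sum>k. measure cantor (eff_open (W k) (idx k) \<inter> ?E n))"
      by (rule cantor.finite_measure_subadditive_countably[OF _ summable]) auto
    also have "\<dots> \<le> (\<Sum>k. (1 / 2) ^ Suc k * (?m / 2))"
      by (rule suminf_le[OF le summable sums_summable[OF sums]])
    also have "\<dots> < ?m" using pos sums_unique[OF sums] by simp
    finally have "measure cantor (G \<inter> ?E n) < ?m" unfolding G_def by (simp add: Int_UN_distrib2)
    then have "\<not> ?E n \<subseteq> G" by (auto dest: Int_absorb1)
    then obtain X where "X \<in> ?E n" "X \<notin> G" by blast
    then show ?thesis using phi_ext_not_phi_inc[OF assms(1)] by blast
  qed
  have "open (G \<union> {X. phi_inc \<Phi> X (map Y [0..<n])})" for n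
    unfolding G_def eff_open_def UN_inc_strings[symmetric] by (intro open_Un open_UN ballI open_cyl)
  moreover have "incseq (\<lambda>n. G \<union> {X. phi_inc \<Phi> X (map Y [0..<n])})"
  proof (rule incseq_SucI)
    fix n
    have "prefix (map Y [0..<n]) (map Y [0..<Suc n])" by simp
    then show "G \<union> {X. phi_inc \<Phi> X (map Y [0..<n])} \<subseteq> G \<union> {X. phi_inc \<Phi> X (map Y [0..<Suc n])}"
      using phi_inc_prefix by blast
  qed
  \<comment> \<open>The complements are nested nonempty closed sets; a common point serves all
    \<open>n\<close> simultaneously.\<close>
  ultimately have "(\<Union>n. G \<union> {X. phi_inc \<Phi> X (map Y [0..<n])}) \<noteq> UNIV"
    by (rule nested_open_cover) (rule ne)
  then obtain X where X: "X \<notin> G" "\<And>n. \<not> phi_inc \<Phi> X (map Y [0..<n])" by blast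
  \<comment> \<open>Each test occurs as some \<open>W k\<close>, and its component
    \<open>idx k\<close> lies in \<open>G\<close>, which \<open>X\<close> avoids.\<close>
  have "X \<in> W2R cantor"
    unfolding W2R_def
  proof (clarify)
    fix V assume V: "ce_natstr V" "(\<lambda>i. measure cantor (eff_open V i)) \<longlonglongrightarrow> 0"
      "X \<in> (\<Inter>i. eff_open V i)"
    then have "V \<in> tests" by (simp add: tests_def)
    then obtain k where "W k = V" using T unfolding W_def by (metis imageE subsetD)
    then show False using X(1) V(3) unfolding G_def by blast
  qed
  then show ?thesis using W2R_phi_dom[OF assms(1,2)] phi_apply_eqI X(2) by blast
qed

end
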